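(* There exist $\tau_0>0$ and a function $\kappa_c:[\tau_0,\infty)\to(0,2)$ with $\kappa_c(\tau)\to0$ as $\tau\to\infty$, such that for every $\tau\ge\tau_0$ the following holds: if $n=n(d)$ satisfies $n/d^2\to\tau$ as $n,d\to\infty$, and for each $d$ the matrices $W_1,\dots,W_n$ are i.i.d. $\mathrm{GOE}(d)$, then with probability tending to $1$ as $d\to\infty$ there exists $\varepsilon\in\{\pm1\}^n$ such that $$\frac{1}{\sqrt n}\left\|\sum_{i=1}^n\varepsilon_iW_i\right\|_{\mathrm{op}}\le\kappa_c(\tau)<2 .$$
   Context: $\mathrm{GOE}(d)$ is the law of a random real symmetric $d\times d$ matrix $Y$ whose entries $(Y_{ij})_{i\le j}$ are independent with $Y_{ij}\sim\mathcal N(0,(1+\delta_{ij})/d)$. $\|\cdot\|_{\mathrm{op}}$ is the operator (spectral) norm. *)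

theory Defs
  imports "HOL-Probability.Probability"
begin

text \<open>
  As the dimension \<open>d\<close> is a variable of the statement, a real \<open>d\<times>d\<close> matrix is a function on index
  pairs, of which only the values on \<open>{..<d} \<times> {..<d}\<close> matter.
\<close>

definition matrix_algebra :: "nat \<Rightarrow> (nat \<times> nat \<Rightarrow> real) measure" where
  "matrix_algebra d = Pi\<^sub>M ({..<d} \<times> {..<d}) (\<lambda>_. borel)"

text \<open>The second argument of \<^const>\<open>normal_density\<close> is the standard deviation, not the variance.\<close>

definition GOE_entry :: "nat \<Rightarrow> nat \<times> nat \<Rightarrow> real measure" where
  "GOE_entry d = (\<lambda>(i, j).
     density lborel (normal_density 0 (sqrt ((1 + of_bool (i = j)) / real d))))"

definition GOE :: "nat \<Rightarrow> (nat \<times> nat \<Rightarrow> real) measure" where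
  "GOE d = distr (Pi\<^sub>M {(i, j). i \<le> j \<and> j < d} (GOE_entry d)) (matrix_algebra d)
     (\<lambda>g. \<lambda>(i, j)\<in>{..<d} \<times> {..<d}. g (min i j, max i j))"

definition op_norm :: "nat \<Rightarrow> (nat \<times> nat \<Rightarrow> real) \<Rightarrow> real" where
  "op_norm d A =
     (SUP x\<in>{x. L2_set x {..<d} \<le> 1}. L2_set (\<lambda>i. \<Sum>j<d. A (i, j) * x j) {..<d})"

end

theory Submission
  imports Defs
begin

text \<open>
  For signs \<open>\<epsilon>\<close> put \<open>A \<epsilon> = \<Sum>i<n. \<epsilon> i * W i\<close>. Typical signs give an operator norm of order \<open>sqrt n\<close>; the
  better signs come from partial colouring. Given a set \<open>S\<close> of \<open>s\<close> indices, at least half of the \<open>2 ^ s\<close>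
  signings of \<open>S\<close> have \<open>\<parallel>A \<epsilon>\<parallel> \<le> R\<close> with \<open>R\<close> of order \<open>sqrt n\<close>. The symmetric matrices form a space of
  dimension about \<open>d\<^sup>2 / 2\<close>, so this ball is covered by \<open>exp (C * d\<^sup>2)\<close> balls of radius \<open>\<delta> * sqrt n\<close>, where
  \<open>C\<close> depends on \<open>\<delta>\<close> and \<open>R / sqrt n\<close> only. If \<open>s\<close> is a large multiple of \<open>d\<^sup>2\<close>, then by the pigeonhole principle one small
  ball receives more than \<open>(3 / 2) ^ s\<close> signings, hence two signings that differ in more than \<open>s / 8\<close>
  places. Half their difference has values in \<open>{-1, 0, 1}\<close>, signs more than an eighth of \<open>S\<close>, and gives a
  matrix of norm \<open>O(\<delta> * sqrt n)\<close> (\<open>exists_partial_colouring\<close>). Repeating this a bounded number of times on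
  the indices that still have the value \<open>0\<close> leaves at most \<open>\<eta> * n\<close> of them, and these receive typical
  signs (\<open>exists_signing_of_small_op_norm\<close>).

  The cost of typical signs on \<open>S\<close> is governed by the supremum of \<open>\<Sum>i\<in>S. (u \<bullet> W i u)\<^sup>2\<close> over unit vectors
  \<open>u\<close>. It must be of order \<open>n / d\<close> for every \<open>S\<close>, and a small multiple of \<open>n / d\<close> for all sets \<open>S\<close> with at
  most \<open>\<eta> * n\<close> elements at once. Both follow from the predicate \<open>spread\<close>, the only random input besides
  symmetry. It holds with probability at least \<open>1 - exp (18 * d - \<beta> * n / 16)\<close>: squares of Gaussian variables have
  exponential moments, and a net of \<open>exp (18 * d)\<close> vectors controls the operator norm
  (\<open>abs_quad_le_of_sphere_net\<close>, \<open>prob_excess_gt_le\<close>).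

  The covering is obtained from the integer lattice. Rounding each entry of a matrix to a multiple of
  \<open>h\<close> in an unbiased random way makes an error of norm \<open>O(h * sqrt d)\<close>, like a random sign matrix,
  whereas nearest-point rounding only guarantees \<open>O(h * d)\<close>. Hence \<open>h\<close> may be as large as a multiple of
  \<open>\<delta> * sqrt (n / d)\<close>. The lattice matrices that arise then have squared Frobenius norm \<open>O(d\<^sup>2)\<close> in units of \<open>h\<^sup>2\<close>,
  and there are only \<open>exp (O(d\<^sup>2))\<close> of them.

  All this gives, for each fixed \<open>\<kappa>\<close>, a threshold for \<open>\<tau>\<close> above which \<open>\<kappa> * sqrt n\<close> is achieved with high
  probability (\<open>exists_aspect_ratio_threshold\<close>); \<open>\<kappa>\<^sub>c \<tau>\<close> is then the best value \<open>1 / (m + 1)\<close> whose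
  threshold lies below \<open>\<tau>\<close>.
\<close>

section \<open>Simultaneous rounding\<close>

text \<open>
  Hoeffding's bound for the variable that is \<open>1 - p\<close> with probability \<open>p\<close> and \<open>- p\<close> otherwise.
\<close>

lemma two_point_mgf_le:
  fixes c p :: real
  assumes "0 \<le> p" "p \<le> 1"
  shows "(1 - p) * exp (- (c * p)) + p * exp (c * (1 - p)) \<le> exp (c\<^sup>2 / 8)"
proof -
  have nonneg: "(1 - p) * exp (- (c * p)) + p * exp (c * (1 - p)) \<le> exp (c\<^sup>2 / 8)"
    if "0 \<le> p" "p \<le> 1" "0 \<le> c" for c p :: real
  proof -
    have "1 + p * (exp c - 1) \<ge> 1"
      using that by simp
    then have "(1 - p) * exp (- (c * p)) + p * exp (c * (1 - p))
        = exp (- c * p + ln (1 + p * (exp c - 1)))"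
      by (simp add: exp_add algebra_simps exp_diff exp_minus field_simps)
    also have "\<dots> \<le> exp (c\<^sup>2 / 8)"
      using Hoeffdings_lemma_aux[OF that(3,1)] by simp
    finally show ?thesis .
  qed
  show ?thesis
  proof (cases "0 \<le> c")
    case True
    then show ?thesis using nonneg assms by simp
  next
    case False
    then show ?thesis
      using nonneg[of "1 - p" "- c"] assms by (simp add: algebra_simps)
  qed
qed

text \<open>
  Round the numbers \<open>p i\<close> one at a time. An unbiased random choice of \<open>b i\<close> has mean \<open>p i\<close>, so by
  Hoeffding's bound it does not increase the sum on average; hence one of the two choices does not
  increase it.
\<close>

lemma exists_rounding_mgf_le:
  fixes c :: "'u \<Rightarrow> 'i \<Rightarrow> real" and p :: "'i \<Rightarrow> real"
  assumes "finite I" and "\<And>i. i \<in> I \<Longrightarrow> 0 \<le> p i \<and> p i \<le> 1"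
    and "\<And>u. u \<in> U \<Longrightarrow> 0 \<le> w u"
  shows "\<exists>b \<in> I \<rightarrow> {0, 1}. (\<Sum>u\<in>U. w u * exp (\<Sum>i\<in>I. c u i * (b i - p i)))
      \<le> (\<Sum>u\<in>U. w u * exp (\<Sum>i\<in>I. (c u i)\<^sup>2 / 8))"
  using assms
proof (induction I arbitrary: w rule: finite_induct)
  case empty
  then show ?case by auto
next
  case (insert k I)
  define w' where "w' y u = w u * exp (c u k * (y - p k))" for y u
  define B where "B y = (\<Sum>u\<in>U. w' y u * exp (\<Sum>i\<in>I. (c u i)\<^sup>2 / 8))" for y :: real
  have pk: "0 \<le> p k" "p k \<le> 1" using insert.prems by auto
  have "(1 - p k) * B 0 + p k * B 1
      = (\<Sum>u\<in>U. w u * exp (\<Sum>i\<in>I. (c u i)\<^sup>2 / 8)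
          * ((1 - p k) * exp (- (c u k * p k)) + p k * exp (c u k * (1 - p k))))"
    unfolding B_def w'_def sum_distrib_left sum.distrib[symmetric]
    by (intro sum.cong) (auto simp: algebra_simps)
  also have "\<dots> \<le> (\<Sum>u\<in>U. w u * exp (\<Sum>i\<in>I. (c u i)\<^sup>2 / 8) * exp ((c u k)\<^sup>2 / 8))"
    using insert.prems by (intro sum_mono mult_left_mono two_point_mgf_le pk) auto
  also have "\<dots> = (\<Sum>u\<in>U. w u * exp (\<Sum>i\<in>insert k I. (c u i)\<^sup>2 / 8))"
    using insert.hyps by (simp add: exp_add mult_ac)
  finally have avg: "(1 - p k) * B 0 + p k * B 1
      \<le> (\<Sum>u\<in>U. w u * exp (\<Sum>i\<in>insert k I. (c u i)\<^sup>2 / 8))" (is "_ \<le> ?R") .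
  obtain y where y: "y \<in> {0, 1}" "B y \<le> ?R"
  proof (cases "B 0 \<le> ?R")
    case False
    have "B 1 \<le> ?R"
    proof (rule ccontr)
      assume "\<not> B 1 \<le> ?R"
      have "?R = (1 - p k) * ?R + p k * ?R" by (simp add: algebra_simps)
      also have "\<dots> < (1 - p k) * B 0 + p k * B 1"
      proof (cases "p k = 0")
        case True
        then show ?thesis using False by simp
      next
        case pos: False
        then show ?thesis
          using False \<open>\<not> B 1 \<le> ?R\<close> pk
          by (intro add_le_less_mono mult_left_mono mult_strict_left_mono) auto
      qed
      finally show False using avg by simp
    qed
    then show ?thesis using that by blast
  qed (use that in blast)
  obtain b where b: "b \<in> I \<rightarrow> {0, 1}"
    "(\<Sum>u\<in>U. w' y u * exp (\<Sum>i\<in>I. c u i * (b i - p i))) \<le> B y"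
    using insert.IH[of "w' y"] insert.prems unfolding B_def w'_def by fastforce
  define b' where "b' = b(k := y)"
  have "(\<Sum>u\<in>U. w u * exp (\<Sum>i\<in>insert k I. c u i * (b' i - p i)))
      = (\<Sum>u\<in>U. w' y u * exp (\<Sum>i\<in>I. c u i * (b i - p i)))"
  proof (intro sum.cong refl)
    fix u
    have "(\<Sum>i\<in>I. c u i * (b' i - p i)) = (\<Sum>i\<in>I. c u i * (b i - p i))"
      using insert.hyps by (intro sum.cong) (auto simp: b'_def)
    then show "w u * exp (\<Sum>i\<in>insert k I. c u i * (b' i - p i))
        = w' y u * exp (\<Sum>i\<in>I. c u i * (b i - p i))"
      using insert.hyps by (simp add: w'_def exp_add b'_def)
  qed
  with b(2) y(2) have "(\<Sum>u\<in>U. w u * exp (\<Sum>i\<in>insert k I. c u i * (b' i - p i))) \<le> ?R"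
    by simp
  moreover have "b' \<in> insert k I \<rightarrow> {0, 1}"
    using b(1) y(1) unfolding b'_def Pi_iff by simp
  ultimately show ?case by blast
qed

text \<open>
  The potential function is the sum of \<open>exp (\<plusminus> \<theta> * x)\<close> over all the linear forms \<open>x\<close> that have to be
  small; a bound on the sum bounds each term.
\<close>

lemma exists_rounding_uniformly_close:
  fixes c :: "'u \<Rightarrow> 'i \<Rightarrow> real" and p :: "'i \<Rightarrow> real"
  assumes I: "finite I" and p: "\<And>i. i \<in> I \<Longrightarrow> 0 \<le> p i \<and> p i \<le> 1"
    and U: "finite U" "real (card U) \<le> exp L"
    and V: "\<And>u. u \<in> U \<Longrightarrow> (\<Sum>i\<in>I. (c u i)\<^sup>2) \<le> V" and "\<theta> > 0"
  shows "\<exists>b \<in> I \<rightarrow> {0, 1}. \<forall>u\<in>U. \<bar>\<Sum>i\<in>I. c u i * (b i - p i)\<bar> \<le> \<theta> * V / 8 + (L + 1) / \<theta>"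
proof -
  define c' where "c' = (\<lambda>(u, s) i. s * \<theta> * c u i)"
  obtain b where b: "b \<in> I \<rightarrow> {0, 1}"
    "(\<Sum>v\<in>U \<times> {-1, 1}. exp (\<Sum>i\<in>I. c' v i * (b i - p i)))
      \<le> (\<Sum>v\<in>U \<times> {-1, 1}. exp (\<Sum>i\<in>I. (c' v i)\<^sup>2 / 8))"
    using exists_rounding_mgf_le[of I p "U \<times> {-1, 1}" "\<lambda>_. 1" c'] I p by auto
  have "(\<Sum>v\<in>U \<times> {-1, 1}. exp (\<Sum>i\<in>I. (c' v i)\<^sup>2 / 8)) \<le> (\<Sum>v\<in>U \<times> {-1, 1::real}. exp (\<theta>\<^sup>2 * V / 8))"
  proof (rule sum_mono)
    fix v :: "'u \<times> real" assume v: "v \<in> U \<times> {-1, 1}"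
    then have "(\<Sum>i\<in>I. (c' v i)\<^sup>2 / 8) = \<theta>\<^sup>2 * (\<Sum>i\<in>I. (c (fst v) i)\<^sup>2) / 8"
      by (auto simp: c'_def power_mult_distrib sum_distrib_left sum_divide_distrib)
    also have "\<dots> \<le> \<theta>\<^sup>2 * V / 8"
      using v V by (intro divide_right_mono mult_left_mono) auto
    finally show "exp (\<Sum>i\<in>I. (c' v i)\<^sup>2 / 8) \<le> exp (\<theta>\<^sup>2 * V / 8)" by simp
  qed
  also have "\<dots> = 2 * real (card U) * exp (\<theta>\<^sup>2 * V / 8)"
    by (simp add: card_cartesian_product)
  also have "\<dots> \<le> exp 1 * exp L * exp (\<theta>\<^sup>2 * V / 8)"
    using U exp_ge_add_one_self[of 1] by (intro mult_right_mono mult_mono) auto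
  also have "\<dots> = exp (\<theta>\<^sup>2 * V / 8 + (L + 1))"
    by (simp add: exp_add)
  finally have le: "(\<Sum>v\<in>U \<times> {-1, 1}. exp (\<Sum>i\<in>I. c' v i * (b i - p i))) \<le> exp (\<theta>\<^sup>2 * V / 8 + (L + 1))"
    using b(2) by simp
  have "\<bar>\<Sum>i\<in>I. c u i * (b i - p i)\<bar> \<le> \<theta> * V / 8 + (L + 1) / \<theta>" if "u \<in> U" for u
  proof -
    let ?x = "\<Sum>i\<in>I. c u i * (b i - p i)"
    have "s * \<theta> * ?x \<le> \<theta>\<^sup>2 * V / 8 + (L + 1)" if "s \<in> {-1, 1}" for s
    proof -
      have "exp (\<Sum>i\<in>I. c' (u, s) i * (b i - p i)) \<le> exp (\<theta>\<^sup>2 * V / 8 + (L + 1))"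
        using that \<open>u \<in> U\<close> U(1)
        by (intro order.trans[OF member_le_sum le]) auto
      then show ?thesis by (simp add: c'_def sum_distrib_left mult_ac)
    qed
    from this[of 1] this[of "-1"] have "\<theta> * \<bar>?x\<bar> \<le> \<theta>\<^sup>2 * V / 8 + (L + 1)"
      using \<open>\<theta> > 0\<close> by (auto simp: abs_if)
    then have "\<bar>?x\<bar> \<le> (\<theta>\<^sup>2 * V / 8 + (L + 1)) / \<theta>"
      using \<open>\<theta> > 0\<close> by (simp add: field_simps)
    also have "\<dots> = \<theta> * V / 8 + (L + 1) / \<theta>"
      using \<open>\<theta> > 0\<close> by (simp add: field_simps power2_eq_square)
    finally show ?thesis .
  qed
  with b(1) show ?thesis by blast
qed

section \<open>Counting signings\<close>

definition signings :: "'i set \<Rightarrow> ('i \<Rightarrow> real) set" where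
  "signings S = S \<rightarrow>\<^sub>E {-1, 1}"

lemma finite_signings: "finite S \<Longrightarrow> finite (signings S)"
  by (simp add: signings_def finite_PiE)

lemma card_signings: "finite S \<Longrightarrow> card (signings S) = 2 ^ card S"
  by (simp add: signings_def card_PiE numeral_2_eq_2)

lemma sum_signings_exp_le:
  assumes "finite S"
  shows "(\<Sum>\<epsilon>\<in>signings S. exp (\<Sum>i\<in>S. \<epsilon> i * c i)) \<le> 2 ^ card S * exp ((\<Sum>i\<in>S. (c i)\<^sup>2) / 2)"
proof -
  have "(\<Sum>\<epsilon>\<in>signings S. exp (\<Sum>i\<in>S. \<epsilon> i * c i)) = (\<Prod>i\<in>S. \<Sum>e\<in>{-1, 1}. exp (e * c i))"
    using assms unfolding signings_def by (subst prod_sum_PiE) (auto simp: exp_sum)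
  also have "\<dots> \<le> (\<Prod>i\<in>S. 2 * exp ((c i)\<^sup>2 / 2))"
  proof (rule prod_mono, rule conjI)
    fix i
    show "0 \<le> (\<Sum>e\<in>{-1, 1}. exp (e * c i))" by simp
    show "(\<Sum>e\<in>{-1, 1}. exp (e * c i)) \<le> 2 * exp ((c i)\<^sup>2 / 2)"
      using two_point_mgf_le[of "1/2" "2 * c i"] by (simp add: power_mult_distrib)
  qed
  also have "\<dots> = 2 ^ card S * exp ((\<Sum>i\<in>S. (c i)\<^sup>2) / 2)"
    using assms by (simp add: prod.distrib exp_sum sum_divide_distrib)
  finally show ?thesis .
qed

text \<open>
  A union bound over the \<open>2 * card U\<close> tail events, each of which has Gaussian decay in \<open>t\<^sup>2 / V\<close>.
\<close>

lemma card_balanced_signings_ge: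
  fixes a :: "'u \<Rightarrow> 'i \<Rightarrow> real"
  assumes S: "finite S" and U: "finite U" "real (card U) \<le> exp L"
    and V: "\<And>u. u \<in> U \<Longrightarrow> (\<Sum>i\<in>S. (a u i)\<^sup>2) \<le> V" and "V > 0" and t: "t > 0" "2 * V * (L + 2) \<le> t\<^sup>2"
  shows "2 ^ card S \<le> 2 * real (card {\<epsilon> \<in> signings S. \<forall>u\<in>U. \<bar>\<Sum>i\<in>S. \<epsilon> i * a u i\<bar> \<le> t})"
proof -
  let ?good = "{\<epsilon> \<in> signings S. \<forall>u\<in>U. \<bar>\<Sum>i\<in>S. \<epsilon> i * a u i\<bar> \<le> t}"
  let ?bad = "signings S - ?good"
  \<comment> \<open>This \<open>\<theta>\<close> minimises the exponent \<open>\<theta>\<^sup>2 * V / 2 - \<theta> * t\<close>.\<close>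
  define \<theta> where "\<theta> = t / V"
  have "\<theta> > 0" using t \<open>V > 0\<close> by (simp add: \<theta>_def)
  have fin: "finite (signings S)" using S by (rule finite_signings)
  have "real (card ?bad) = (\<Sum>\<epsilon>\<in>?bad. 1)" by simp
  also have "\<dots> \<le> (\<Sum>\<epsilon>\<in>?bad. \<Sum>u\<in>U. \<Sum>s\<in>{-1, 1}. exp (\<Sum>i\<in>S. \<epsilon> i * (s * \<theta> * a u i)) * exp (- (\<theta> * t)))"
  proof (rule sum_mono)
    fix \<epsilon> assume "\<epsilon> \<in> ?bad"
    then obtain u where u: "u \<in> U" and gt: "t < \<bar>\<Sum>i\<in>S. \<epsilon> i * a u i\<bar>" by force
    define s :: real where "s = (if 0 \<le> (\<Sum>i\<in>S. \<epsilon> i * a u i) then 1 else -1)"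
    have "\<theta> * t \<le> \<theta> * (s * (\<Sum>i\<in>S. \<epsilon> i * a u i))"
      using gt \<open>\<theta> > 0\<close> by (intro mult_left_mono) (auto simp: s_def)
    also have "\<dots> = (\<Sum>i\<in>S. \<epsilon> i * (s * \<theta> * a u i))"
      by (simp add: sum_distrib_left mult_ac)
    finally have "1 \<le> exp (\<Sum>i\<in>S. \<epsilon> i * (s * \<theta> * a u i)) * exp (- (\<theta> * t))"
      by (simp flip: exp_add)
    also have "\<dots> \<le> (\<Sum>s\<in>{-1, 1}. exp (\<Sum>i\<in>S. \<epsilon> i * (s * \<theta> * a u i)) * exp (- (\<theta> * t)))"
      by (rule member_le_sum) (auto simp: s_def)
    also have "\<dots> \<le> (\<Sum>u\<in>U. \<Sum>s\<in>{-1, 1}. exp (\<Sum>i\<in>S. \<epsilon> i * (s * \<theta> * a u i)) * exp (- (\<theta> * t)))"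
      using u U by (intro member_le_sum[of u U]) (auto intro!: sum_nonneg)
    finally show "1 \<le> (\<Sum>u\<in>U. \<Sum>s\<in>{-1, 1}. exp (\<Sum>i\<in>S. \<epsilon> i * (s * \<theta> * a u i)) * exp (- (\<theta> * t)))" .
  qed
  also have "\<dots> \<le> (\<Sum>\<epsilon>\<in>signings S. \<Sum>u\<in>U. \<Sum>s\<in>{-1, 1}. exp (\<Sum>i\<in>S. \<epsilon> i * (s * \<theta> * a u i)) * exp (- (\<theta> * t)))"
    using fin by (intro sum_mono2) (auto intro!: sum_nonneg)
  also have "\<dots> = (\<Sum>u\<in>U. \<Sum>s\<in>{-1, 1}. \<Sum>\<epsilon>\<in>signings S. exp (\<Sum>i\<in>S. \<epsilon> i * (s * \<theta> * a u i)) * exp (- (\<theta> * t)))"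
    by (subst sum.swap, intro sum.cong refl, subst sum.swap) simp
  also have "\<dots> \<le> (\<Sum>u\<in>U. \<Sum>s\<in>{-1, 1::real}. 2 ^ card S * exp (- (L + 2)))"
  proof (intro sum_mono)
    fix u s assume u: "u \<in> U" and s: "s \<in> {-1, 1::real}"
    have "(\<Sum>\<epsilon>\<in>signings S. exp (\<Sum>i\<in>S. \<epsilon> i * (s * \<theta> * a u i)) * exp (- (\<theta> * t)))
        \<le> (2 ^ card S * exp ((\<Sum>i\<in>S. (s * \<theta> * a u i)\<^sup>2) / 2)) * exp (- (\<theta> * t))"
      unfolding sum_distrib_right[symmetric]
      by (intro mult_right_mono sum_signings_exp_le S) auto
    also have "(\<Sum>i\<in>S. (s * \<theta> * a u i)\<^sup>2) = \<theta>\<^sup>2 * (\<Sum>i\<in>S. (a u i)\<^sup>2)"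
      using s by (auto simp: power_mult_distrib sum_distrib_left)
    also have "2 ^ card S * exp (\<theta>\<^sup>2 * (\<Sum>i\<in>S. (a u i)\<^sup>2) / 2) * exp (- (\<theta> * t))
        = 2 ^ card S * exp (\<theta>\<^sup>2 * (\<Sum>i\<in>S. (a u i)\<^sup>2) / 2 - \<theta> * t)"
      by (simp only: diff_conv_add_uminus exp_add mult.assoc)
    also have "\<dots> \<le> 2 ^ card S * exp (- (L + 2))"
    proof -
      have "\<theta>\<^sup>2 * (\<Sum>i\<in>S. (a u i)\<^sup>2) / 2 - \<theta> * t \<le> \<theta>\<^sup>2 * V / 2 - \<theta> * t"
        using V[OF u] by (simp add: mult_left_mono)
      also have "\<dots> = - (t\<^sup>2 / (2 * V))"
        using \<open>V > 0\<close> by (simp add: \<theta>_def field_simps power2_eq_square)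
      also have "\<dots> \<le> - (L + 2)"
        using t(2) \<open>V > 0\<close> by (simp add: field_simps)
      finally show ?thesis by simp
    qed
    finally show "(\<Sum>\<epsilon>\<in>signings S. exp (\<Sum>i\<in>S. \<epsilon> i * (s * \<theta> * a u i)) * exp (- (\<theta> * t)))
        \<le> 2 ^ card S * exp (- (L + 2))" .
  qed
  also have "\<dots> = 2 ^ card S * (2 * exp (- 2) * (real (card U) * exp (- L)))"
    by (simp add: exp_diff exp_minus field_simps)
  also have "\<dots> \<le> 2 ^ card S * (1 / 2 * 1)"
  proof -
    have "4 \<le> exp (2::real)"
      using power_mono[of 2 "exp 1 :: real" 2] exp_ge_add_one_self[of 1] by (simp flip: exp_of_nat_mult)
    then have "2 * exp (- 2) \<le> (1 / 2 :: real)"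
      by (simp add: exp_minus field_simps)
    moreover have "real (card U) * exp (- L) \<le> 1"
      using U(2) by (simp add: exp_minus field_simps)
    ultimately show ?thesis by (intro mult_left_mono mult_mono) auto
  qed
  finally have bad: "real (card ?bad) \<le> 2 ^ card S / 2" by simp
  have "card (signings S) = card ?good + card ?bad"
    using card_Int_Diff[OF fin, of ?good] by (simp add: Int_absorb1)
  then have "real (2 ^ card S) = real (card ?good + card ?bad)"
    unfolding card_signings[OF S] by (rule arg_cong)
  then show ?thesis
    using bad unfolding of_nat_add of_nat_power of_nat_numeral by linarith
qed

text \<open>
  A Chernoff bound for a Hamming ball: every signing is weighted by \<open>4 powr (s / 8) / 4 ^ k\<close>, where \<open>k\<close> is its
  distance from \<open>\<delta>\<close>. This weight is at least \<open>1\<close> in the ball, and the total weight is at most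
  \<open>(4 powr (1 / 8) * (5 / 4)) ^ s\<close>, where \<open>4 powr (1 / 8) \<le> 6 / 5\<close>.
\<close>

lemma card_near_signings_le:
  assumes S: "finite S"
  shows "real (card {\<epsilon> \<in> signings S. 8 * card {i \<in> S. \<epsilon> i \<noteq> \<delta> i} \<le> card S}) \<le> (3 / 2) ^ card S"
    (is "real (card ?N) \<le> _")
proof -
  let ?k = "\<lambda>\<epsilon>. card {i \<in> S. \<epsilon> i \<noteq> \<delta> i}"
  define r :: real where "r = 4 powr (1 / 8)"
  have "r > 0" by (simp add: r_def)
  have r8: "r ^ 8 = 4" by (simp add: r_def powr_power)
  have "r \<le> 6 / 5"
    by (rule power_le_imp_le_base[of _ 7]) (simp_all add: r8 power_divide)
  have "real (card ?N) = (\<Sum>\<epsilon>\<in>?N. 1)" by simp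
  also have "\<dots> \<le> (\<Sum>\<epsilon>\<in>?N. r ^ card S * (1 / 4) ^ ?k \<epsilon>)"
  proof (rule sum_mono)
    fix \<epsilon> assume "\<epsilon> \<in> ?N"
    then have "r ^ (8 * ?k \<epsilon>) \<le> r ^ card S"
      using power_increasing[of "8 * ?k \<epsilon>" "card S" r] r8 by (simp add: r_def)
    then have "4 ^ ?k \<epsilon> \<le> r ^ card S" by (simp add: power_mult r8)
    then show "1 \<le> r ^ card S * (1 / 4) ^ ?k \<epsilon>"
      by (simp add: field_simps power_divide)
  qed
  also have "\<dots> \<le> (\<Sum>\<epsilon>\<in>signings S. r ^ card S * (1 / 4) ^ ?k \<epsilon>)"
    using S \<open>r > 0\<close> by (intro sum_mono2 finite_signings) auto
  also have "\<dots> = r ^ card S * (\<Sum>\<epsilon>\<in>signings S. \<Prod>i\<in>S. if \<epsilon> i \<noteq> \<delta> i then 1 / 4 else 1)"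
    using S by (simp add: sum_distrib_left prod.If_cases Int_def)
  also have "\<dots> = r ^ card S * (\<Prod>i\<in>S. \<Sum>e\<in>{-1, 1}. if e \<noteq> \<delta> i then 1 / 4 else 1)"
    unfolding signings_def using S by (subst prod_sum_PiE) auto
  also have "\<dots> \<le> (6 / 5) ^ card S * (5 / 4) ^ card S"
  proof (intro mult_mono power_mono)
    have "(\<Prod>i\<in>S. \<Sum>e\<in>{-1, 1}. if e \<noteq> \<delta> i then 1 / 4 else (1::real)) \<le> (\<Prod>i\<in>S. 5 / 4)"
      by (intro prod_mono) auto
    then show "(\<Prod>i\<in>S. \<Sum>e\<in>{-1, 1}. if e \<noteq> \<delta> i then 1 / 4 else (1::real)) \<le> (5 / 4) ^ card S"
      by simp
  qed (use \<open>r > 0\<close> \<open>r \<le> 6 / 5\<close> in \<open>auto intro!: prod_nonneg\<close>)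
  also have "\<dots> = (3 / 2) ^ card S"
    by (simp flip: power_mult_distrib)
  finally show ?thesis .
qed

text \<open>
  Otherwise every fibre of \<open>\<Phi>\<close> lies in a Hamming ball around any one of its points.
\<close>

lemma exists_distant_signings_in_fibre:
  assumes S: "finite S" and F: "finite F" "\<Phi> ` G \<subseteq> F" and G: "G \<subseteq> signings S"
    and large: "(3 / 2) ^ card S * real (card F) < real (card G)"
  shows "\<exists>\<epsilon>\<in>G. \<exists>\<delta>\<in>G. \<Phi> \<epsilon> = \<Phi> \<delta> \<and> card S < 8 * card {i \<in> S. \<epsilon> i \<noteq> \<delta> i}"
proof (rule ccontr)
  assume neg: "\<not> ?thesis"
  have finG: "finite G" using G finite_signings[OF S] by (rule finite_subset)
  have "real (card G) = (\<Sum>y\<in>F. real (card {\<epsilon> \<in> G. \<Phi> \<epsilon> = y}))"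
  proof -
    have "card G = card (\<Union>y\<in>F. {\<epsilon> \<in> G. \<Phi> \<epsilon> = y})"
      using F(2) by (intro arg_cong[where f=card]) auto
    also have "\<dots> = (\<Sum>y\<in>F. card {\<epsilon> \<in> G. \<Phi> \<epsilon> = y})"
      using F finG by (intro card_UN_disjoint) auto
    finally show ?thesis by simp
  qed
  also have "\<dots> \<le> (\<Sum>y\<in>F. (3 / 2) ^ card S)"
  proof (rule sum_mono)
    fix y
    show "real (card {\<epsilon> \<in> G. \<Phi> \<epsilon> = y}) \<le> (3 / 2) ^ card S"
    proof (cases "{\<epsilon> \<in> G. \<Phi> \<epsilon> = y} = {}")
      case True
      then show ?thesis by (simp only: card.empty) simp
    next
      case False
      then obtain \<delta> where \<delta>: "\<delta> \<in> G" "\<Phi> \<delta> = y" by blast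
      have "{\<epsilon> \<in> G. \<Phi> \<epsilon> = y} \<subseteq> {\<epsilon> \<in> signings S. 8 * card {i \<in> S. \<epsilon> i \<noteq> \<delta> i} \<le> card S}"
        using neg \<delta> G by (fastforce simp: not_less)
      then have "card {\<epsilon> \<in> G. \<Phi> \<epsilon> = y}
          \<le> card {\<epsilon> \<in> signings S. 8 * card {i \<in> S. \<epsilon> i \<noteq> \<delta> i} \<le> card S}"
        using finite_signings[OF S] by (intro card_mono) auto
      then show ?thesis
        using card_near_signings_le[OF S, of \<delta>] by linarith
    qed
  qed
  finally show False using large by (simp add: mult.commute)
qed

section \<open>Lattice points in a ball\<close>

text \<open>
  Compare with the geometric series: \<open>exp (- k\<^sup>2) \<le> 2 powr (- k)\<close>. The induction needs the exact remainder
  \<open>2 / 2 ^ k\<close>.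
\<close>

lemma sum_exp_neg_square_int_le: "(\<Sum>z = - int k..int k. exp (- (real_of_int z)\<^sup>2)) \<le> 3"
proof -
  have "(\<Sum>z = - int k..int k. exp (- (real_of_int z)\<^sup>2)) \<le> 3 - 2 / 2 ^ k"
  proof (induction k)
    case (Suc k)
    have "{- int (Suc k)..int (Suc k)} = insert (- int (Suc k)) (insert (int (Suc k)) {- int k..int k})"
      by auto
    then have "(\<Sum>z = - int (Suc k)..int (Suc k). exp (- (real_of_int z)\<^sup>2))
        = 2 * exp (- (real (Suc k))\<^sup>2) + (\<Sum>z = - int k..int k. exp (- (real_of_int z)\<^sup>2))"
      by (simp add: power2_eq_square algebra_simps)
    moreover have "exp (- (real (Suc k))\<^sup>2) \<le> 1 / 2 ^ Suc k"
    proof -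
      have "(2::real) ^ Suc k \<le> exp 1 ^ Suc k"
        using exp_ge_add_one_self[of 1] by (intro power_mono) auto
      also have "\<dots> = exp (real (Suc k))" using exp_of_nat_mult[of "Suc k" "1::real"] by (simp only: mult_1_right)
      also have "\<dots> \<le> exp ((real (Suc k))\<^sup>2)"
        by (simp add: power2_eq_square)
      finally show ?thesis by (simp add: exp_minus field_simps)
    qed
    ultimately show ?case using Suc.IH by simp
  qed simp
  also have "\<dots> \<le> 3" by simp
  finally show ?thesis .
qed

text \<open>
  Weighting each lattice point by \<open>exp (T - |z|\<^sup>2)\<close> turns the count into a product of one-dimensional
  theta sums. The bound is exponential in the dimension when \<open>T\<close> is proportional to it, which is what
  makes lattices as good as volumetric coverings here.
\<close>

lemma card_lattice_points_in_ball_le: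
  fixes T :: real
  assumes I: "finite I"
  defines "B \<equiv> {z \<in> I \<rightarrow>\<^sub>E (UNIV :: int set). (\<Sum>i\<in>I. (real_of_int (z i))\<^sup>2) \<le> T}"
  shows "finite B" and "real (card B) \<le> exp T * 3 ^ card I"
proof -
  define k where "k = nat \<lceil>T\<rceil>"
  let ?P = "I \<rightarrow>\<^sub>E {- int k..int k}"
  have sub: "B \<subseteq> ?P"
  proof
    fix z assume z: "z \<in> B"
    have "z i \<in> {- int k..int k}" if "i \<in> I" for i
    proof -
      have "\<bar>z i\<bar> \<le> (z i)\<^sup>2"
        using self_le_power[of "\<bar>z i\<bar>" 2] by (cases "z i = 0") simp_all
      then have "real_of_int \<bar>z i\<bar> \<le> real_of_int ((z i)\<^sup>2)"
        by (simp only: of_int_le_iff)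
      also have "\<dots> = (real_of_int (z i))\<^sup>2" by simp
      also have "\<dots> \<le> (\<Sum>i\<in>I. (real_of_int (z i))\<^sup>2)"
        using I that by (intro member_le_sum) auto
      also have "\<dots> \<le> T" using z by (simp add: B_def)
      finally have "\<bar>z i\<bar> \<le> \<lceil>T\<rceil>" by linarith
      then have "\<bar>z i\<bar> \<le> int k" unfolding k_def by linarith
      then show ?thesis by auto
    qed
    then show "z \<in> ?P" using z by (auto simp: B_def PiE_def)
  qed
  have finP: "finite ?P" using I by (simp add: finite_PiE)
  show finB: "finite B" using sub finP by (rule finite_subset)
  have "real (card B) = (\<Sum>z\<in>B. 1)" by simp
  also have "\<dots> \<le> (\<Sum>z\<in>B. exp T * exp (- (\<Sum>i\<in>I. (real_of_int (z i))\<^sup>2)))"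
    by (intro sum_mono) (simp add: B_def flip: exp_add)
  also have "\<dots> \<le> (\<Sum>z\<in>?P. exp T * exp (- (\<Sum>i\<in>I. (real_of_int (z i))\<^sup>2)))"
    using sub finP by (intro sum_mono2) auto
  also have "\<dots> = exp T * (\<Prod>i\<in>I. \<Sum>z = - int k..int k. exp (- (real_of_int z)\<^sup>2))"
    using I by (subst prod_sum_PiE) (auto simp: sum_distrib_left exp_sum simp flip: sum_negf)
  also have "\<dots> \<le> exp T * (\<Prod>i\<in>I. 3)"
    by (intro mult_left_mono prod_mono) (auto intro: sum_nonneg sum_exp_neg_square_int_le)
  finally show "real (card B) \<le> exp T * 3 ^ card I" by simp
qed

section \<open>Quadratic forms and a net of the sphere\<close>

definition sqnorm :: "nat \<Rightarrow> (nat \<Rightarrow> real) \<Rightarrow> real" where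
  "sqnorm d x = (\<Sum>i<d. (x i)\<^sup>2)"

definition bilin :: "nat \<Rightarrow> (nat \<times> nat \<Rightarrow> real) \<Rightarrow> (nat \<Rightarrow> real) \<Rightarrow> (nat \<Rightarrow> real) \<Rightarrow> real" where
  "bilin d A x y = (\<Sum>i<d. \<Sum>j<d. A (i, j) * x i * y j)"

abbreviation quad :: "nat \<Rightarrow> (nat \<times> nat \<Rightarrow> real) \<Rightarrow> (nat \<Rightarrow> real) \<Rightarrow> real" where
  "quad d A x \<equiv> bilin d A x x"

definition symmetric_matrix :: "nat \<Rightarrow> (nat \<times> nat \<Rightarrow> real) \<Rightarrow> bool" where
  "symmetric_matrix d A \<longleftrightarrow> (\<forall>i<d. \<forall>j<d. A (i, j) = A (j, i))"

lemma sqnorm_nonneg [simp]: "0 \<le> sqnorm d x"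
  by (simp add: sqnorm_def sum_nonneg)

lemma sqnorm_scale: "sqnorm d (\<lambda>i. c * x i) = c\<^sup>2 * sqnorm d x"
  by (simp add: sqnorm_def power_mult_distrib sum_distrib_left)

lemma sqnorm_parallelogram:
  "sqnorm d (\<lambda>i. x i + y i) + sqnorm d (\<lambda>i. x i - y i) = 2 * sqnorm d x + 2 * sqnorm d y"
  unfolding sqnorm_def sum_distrib_left sum.distrib[symmetric]
  by (intro sum.cong) (auto simp: power2_eq_square algebra_simps)

lemma bilin_scale: "bilin d A (\<lambda>i. a * x i) (\<lambda>i. b * y i) = a * b * bilin d A x y"
  by (simp add: bilin_def sum_distrib_left mult_ac)

lemma bilin_commute:
  assumes "symmetric_matrix d A"
  shows "bilin d A x y = bilin d A y x"
  unfolding bilin_def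
  by (subst sum.swap, intro sum.cong refl) (use assms in \<open>auto simp: symmetric_matrix_def\<close>)

lemma bilin_polarization:
  assumes "symmetric_matrix d A"
  shows "4 * bilin d A x y = quad d A (\<lambda>i. x i + y i) - quad d A (\<lambda>i. x i - y i)"
proof -
  have "quad d A (\<lambda>i. x i + y i) - quad d A (\<lambda>i. x i - y i) = 2 * bilin d A x y + 2 * bilin d A y x"
    unfolding bilin_def sum_distrib_left sum.distrib[symmetric] sum_subtractf[symmetric]
    by (intro sum.cong refl) (simp add: algebra_simps)
  then show ?thesis using bilin_commute[OF assms, of x y] by simp
qed

lemma quad_diff:
  assumes "symmetric_matrix d A"
  shows "quad d A x - quad d A y = bilin d A (\<lambda>i. x i - y i) (\<lambda>i. x i + y i)"
proof -
  have "bilin d A (\<lambda>i. x i - y i) (\<lambda>i. x i + y i)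
      = quad d A x - quad d A y + bilin d A x y - bilin d A y x"
    unfolding bilin_def sum.distrib[symmetric] sum_subtractf[symmetric]
    by (intro sum.cong refl) (simp add: algebra_simps)
  then show ?thesis using bilin_commute[OF assms, of x y] by simp
qed

text \<open>
  Polarization applied to the vectors \<open>sqrt s * x\<close> and \<open>y / sqrt s\<close>. The free parameter \<open>s\<close> allows the two
  terms on the right to be balanced.
\<close>

lemma abs_bilin_le_quad_bound:
  assumes A: "symmetric_matrix d A" and m: "\<And>x. \<bar>quad d A x\<bar> \<le> m * sqnorm d x" and "s > 0"
  shows "\<bar>bilin d A x y\<bar> \<le> m / 2 * (s * sqnorm d x + sqnorm d y / s)"
proof -
  define e where "e = (\<lambda>i. sqrt s * x i)"
  define f where "f = (\<lambda>i. 1 / sqrt s * y i)"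
  have "bilin d A e f = bilin d A x y"
    using \<open>s > 0\<close> by (simp only: e_def f_def bilin_scale) simp
  then have "4 * \<bar>bilin d A x y\<bar> \<le> \<bar>quad d A (\<lambda>i. e i + f i)\<bar> + \<bar>quad d A (\<lambda>i. e i - f i)\<bar>"
    using bilin_polarization[OF A, of e f] by linarith
  also have "\<dots> \<le> m * (sqnorm d (\<lambda>i. e i + f i) + sqnorm d (\<lambda>i. e i - f i))"
    using m[of "\<lambda>i. e i + f i"] m[of "\<lambda>i. e i - f i"] by (simp add: algebra_simps)
  also have "\<dots> = 2 * m * (s * sqnorm d x + sqnorm d y / s)"
    unfolding sqnorm_parallelogram e_def f_def sqnorm_scale
    using \<open>s > 0\<close> by (simp add: power_divide algebra_simps)
  finally show ?thesis by simp
qed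

text \<open>
  The radius \<open>4 * sqrt d\<close> makes the mesh \<open>1 / (4 * sqrt d)\<close>, so that entrywise rounding moves a vector by
  at most \<open>1 / 4\<close>, and the number of points is still exponential in \<open>d\<close>.
\<close>

definition sphere_net :: "nat \<Rightarrow> (nat \<Rightarrow> real) set" where
  "sphere_net d = (\<lambda>z i. real_of_int (z i) / (4 * sqrt (real d))) `
     {z \<in> {..<d} \<rightarrow>\<^sub>E UNIV. (\<Sum>i<d. (real_of_int (z i))\<^sup>2) \<le> 16 * real d}"

lemma finite_sphere_net: "finite (sphere_net d)"
  unfolding sphere_net_def by (intro finite_imageI card_lattice_points_in_ball_le) simp

lemma card_sphere_net_le: "real (card (sphere_net d)) \<le> exp (18 * real d)"
proof -
  let ?Z = "{z \<in> {..<d} \<rightarrow>\<^sub>E (UNIV :: int set). (\<Sum>i<d. (real_of_int (z i))\<^sup>2) \<le> 16 * real d}"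
  have "real (card (sphere_net d)) \<le> real (card ?Z)"
    unfolding sphere_net_def using card_lattice_points_in_ball_le(1)[of "{..<d}"]
    by (intro of_nat_mono card_image_le) simp
  also have "\<dots> \<le> exp (16 * real d) * 3 ^ d"
    using card_lattice_points_in_ball_le(2)[of "{..<d}"] by simp
  also have "\<dots> \<le> exp (16 * real d) * exp 2 ^ d"
    using exp_ge_add_one_self[of 2] by (intro mult_left_mono power_mono) auto
  also have "\<dots> = exp (18 * real d)"
    by (simp flip: exp_of_nat_mult exp_add)
  finally show ?thesis .
qed

lemma sqnorm_sphere_net_le:
  assumes "u \<in> sphere_net d"
  shows "sqnorm d u \<le> 1"
proof (cases "d = 0")
  case False
  obtain z :: "nat \<Rightarrow> int" where z: "(\<Sum>i<d. (real_of_int (z i))\<^sup>2) \<le> 16 * real d"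
    and u: "u = (\<lambda>i. real_of_int (z i) / (4 * sqrt (real d)))"
    using assms unfolding sphere_net_def by auto
  have "sqnorm d u = (\<Sum>i<d. (real_of_int (z i))\<^sup>2) / (16 * real d)"
    by (simp add: u sqnorm_def power_divide power_mult_distrib sum_divide_distrib)
  also have "\<dots> \<le> 1" using z False by (simp add: field_simps)
  finally show ?thesis .
qed (simp add: sqnorm_def)

text \<open>
  Rounding towards \<open>0\<close> keeps the point inside the ball.
\<close>

lemma sphere_net_approximates:
  assumes "d > 0" "sqnorm d x \<le> 1"
  shows "\<exists>u\<in>sphere_net d. sqnorm d (\<lambda>i. x i - u i) \<le> 1 / 16"
proof -
  define y where "y i = 4 * sqrt (real d) * x i" for i
  define z where "z = (\<lambda>i\<in>{..<d}. if 0 \<le> y i then \<lfloor>y i\<rfloor> else \<lceil>y i\<rceil>)"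
  define u where "u = (\<lambda>i. real_of_int (z i) / (4 * sqrt (real d)))"
  have z: "\<bar>real_of_int (z i)\<bar> \<le> \<bar>y i\<bar>" "\<bar>y i - real_of_int (z i)\<bar> \<le> 1" if "i < d" for i
  proof -
    have "\<bar>real_of_int (z i)\<bar> \<le> \<bar>y i\<bar> \<and> \<bar>y i - real_of_int (z i)\<bar> \<le> 1"
    proof (cases "0 \<le> y i")
      case True
      then have "0 \<le> real_of_int \<lfloor>y i\<rfloor>" by simp
      then show ?thesis using True that by (simp add: z_def) linarith
    next
      case False
      then have "real_of_int \<lceil>y i\<rceil> \<le> 0" by simp
      then show ?thesis using False that ceiling_correct[of "y i"] by (simp add: z_def)
    qed
    then show "\<bar>real_of_int (z i)\<bar> \<le> \<bar>y i\<bar>" "\<bar>y i - real_of_int (z i)\<bar> \<le> 1" by auto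
  qed
  have "(\<Sum>i<d. (real_of_int (z i))\<^sup>2) \<le> (\<Sum>i<d. (y i)\<^sup>2)"
    using z(1) by (intro sum_mono) (simp add: abs_le_square_iff)
  also have "\<dots> = 16 * real d * sqnorm d x"
    by (simp add: y_def sqnorm_def power_mult_distrib sum_distrib_left)
  also have "\<dots> \<le> 16 * real d" using assms(2) by (simp add: mult_left_le)
  finally have le: "(\<Sum>i<d. (real_of_int (z i))\<^sup>2) \<le> 16 * real d" .
  have "z \<in> {..<d} \<rightarrow>\<^sub>E UNIV" by (auto simp: z_def)
  with le have "u \<in> sphere_net d"
    unfolding u_def sphere_net_def by (intro imageI) simp
  moreover have "sqnorm d (\<lambda>i. x i - u i) \<le> 1 / 16"
  proof -
    have "sqnorm d (\<lambda>i. x i - u i) = (\<Sum>i<d. (y i - real_of_int (z i))\<^sup>2 / (16 * real d))"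
    proof -
      have "x i - u i = (y i - real_of_int (z i)) / (4 * sqrt (real d))" for i
        using \<open>d > 0\<close> by (simp add: y_def u_def field_simps)
      then show ?thesis by (simp add: sqnorm_def power_divide power_mult_distrib)
    qed
    also have "\<dots> \<le> (\<Sum>i<d. 1 / (16 * real d))"
      using z(2) by (intro sum_mono divide_right_mono) (auto simp: abs_square_le_1)
    also have "\<dots> = 1 / 16" using \<open>d > 0\<close> by simp
    finally show ?thesis .
  qed
  ultimately show ?thesis by blast
qed

text \<open>
  If \<open>m\<close> bounds the quadratic form on the unit ball, then so does \<open>t + m / 2\<close>, because every point of the
  ball is within \<open>1 / 4\<close> of the net. Iterating from any initial bound converges to the fixed point \<open>2 * t\<close>.
\<close>

lemma abs_quad_le_of_sphere_net:
  assumes "d > 0" and A: "symmetric_matrix d A" and t: "\<And>u. u \<in> sphere_net d \<Longrightarrow> \<bar>quad d A u\<bar> \<le> t"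
  shows "\<bar>quad d A x\<bar> \<le> 2 * t * sqnorm d x"
proof -
  have improve: "\<bar>quad d A x\<bar> \<le> (t + m / 2) * sqnorm d x"
    if m: "\<And>x. \<bar>quad d A x\<bar> \<le> m * sqnorm d x" for m x
  proof (cases "sqnorm d x = 0")
    case True
    then show ?thesis using m[of x] by simp
  next
    case False
    define c where "c = sqrt (sqnorm d x)"
    have "c > 0" using False sqnorm_nonneg[of d x] by (simp add: c_def less_le)
    define y where "y = (\<lambda>i. 1 / c * x i)"
    have y: "sqnorm d y = 1"
      unfolding y_def sqnorm_scale using False by (simp add: c_def power_divide)
    have m0: "m \<ge> 0" using m[of y] abs_ge_zero[of "quad d A y"] unfolding y by linarith
    obtain u where u: "u \<in> sphere_net d" "sqnorm d (\<lambda>i. y i - u i) \<le> 1 / 16"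
      using sphere_net_approximates[of d y] y \<open>d > 0\<close> by auto
    have sum4: "sqnorm d (\<lambda>i. y i + u i) \<le> 4"
      using sqnorm_parallelogram[of d y u] y sqnorm_sphere_net_le[OF u(1)]
        sqnorm_nonneg[of d "\<lambda>i. y i - u i"] by linarith
    \<comment> \<open>The weights \<open>8\<close> and \<open>1 / 8\<close> balance \<open>|y - u|\<^sup>2 \<le> 1 / 16\<close> against \<open>|y + u|\<^sup>2 \<le> 4\<close>.\<close>
    have "\<bar>quad d A y - quad d A u\<bar>
        \<le> m / 2 * (8 * sqnorm d (\<lambda>i. y i - u i) + sqnorm d (\<lambda>i. y i + u i) / 8)"
      unfolding quad_diff[OF A] by (intro abs_bilin_le_quad_bound A m) simp
    also have "\<dots> \<le> m / 2 * (8 * (1 / 16) + 4 / 8)"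
      using m0 u(2) sum4 by (intro mult_left_mono add_mono divide_right_mono) auto
    finally have "\<bar>quad d A y - quad d A u\<bar> \<le> m / 2" by simp
    then have qy: "\<bar>quad d A y\<bar> \<le> t + m / 2"
      using t[OF u(1)] abs_triangle_ineq2[of "quad d A y" "quad d A u"] by linarith
    have "x = (\<lambda>i. c * y i)" using \<open>c > 0\<close> by (simp add: y_def)
    then have "quad d A x = c\<^sup>2 * quad d A y"
      by (metis bilin_scale power2_eq_square)
    then have "\<bar>quad d A x\<bar> \<le> c\<^sup>2 * (t + m / 2)"
      using qy by (simp add: abs_mult mult_left_mono)
    then show ?thesis by (simp add: c_def mult.commute)
  qed
  define m0 where "m0 = (\<Sum>i<d. \<Sum>j<d. \<bar>A (i, j)\<bar>)"
  have start: "\<bar>quad d A x\<bar> \<le> m0 * sqnorm d x" for x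
  proof -
    have "\<bar>quad d A x\<bar> \<le> (\<Sum>i<d. \<Sum>j<d. \<bar>A (i, j) * x i * x j\<bar>)"
      unfolding bilin_def by (intro order.trans[OF sum_abs] sum_mono sum_abs)
    also have "\<dots> \<le> (\<Sum>i<d. \<Sum>j<d. \<bar>A (i, j)\<bar> * sqnorm d x)"
    proof (intro sum_mono)
      fix i j assume ij: "i \<in> {..<d}" "j \<in> {..<d}"
      have "(x k)\<^sup>2 \<le> sqnorm d x" if "k \<in> {..<d}" for k
        unfolding sqnorm_def using that by (intro member_le_sum) auto
      from this[OF ij(1)] this[OF ij(2)] have "\<bar>x i\<bar> * \<bar>x j\<bar> \<le> sqnorm d x"
        using sum_squares_bound[of "\<bar>x i\<bar>" "\<bar>x j\<bar>"] by simp
      then show "\<bar>A (i, j) * x i * x j\<bar> \<le> \<bar>A (i, j)\<bar> * sqnorm d x"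
        by (simp add: abs_mult mult.assoc mult_left_mono)
    qed
    finally show ?thesis by (simp add: m0_def sum_distrib_right)
  qed
  have iterate: "\<bar>quad d A x\<bar> \<le> (2 * t + (m0 - 2 * t) * (1 / 2) ^ k) * sqnorm d x" for k x
  proof (induction k arbitrary: x)
    case 0
    then show ?case using start by simp
  next
    case (Suc k)
    have "t + (2 * t + (m0 - 2 * t) * (1 / 2) ^ k) / 2 = 2 * t + (m0 - 2 * t) * (1 / 2) ^ Suc k"
      by (simp add: field_simps)
    then show ?case using improve[OF Suc.IH, of x] by (simp only:)
  qed
  have "(\<lambda>k. (2 * t + (m0 - 2 * t) * (1 / 2) ^ k) * sqnorm d x) \<longlonglongrightarrow> (2 * t + (m0 - 2 * t) * 0) * sqnorm d x"
    by (intro tendsto_intros LIMSEQ_realpow_zero) auto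
  then show ?thesis
    using iterate by (intro LIMSEQ_le_const[where X = "\<lambda>k. (2 * t + (m0 - 2 * t) * (1 / 2) ^ k) * sqnorm d x"]) auto
qed

text \<open>
  The square of \<open>|A x|\<close> is the bilinear form at \<open>A x\<close> and \<open>x\<close>; the weight \<open>1 / m\<close> lets half of it be absorbed
  on the left.
\<close>

lemma sqnorm_image_le_quad_bound:
  assumes A: "symmetric_matrix d A" and m: "\<And>x. \<bar>quad d A x\<bar> \<le> m * sqnorm d x" and "m > 0"
  shows "sqnorm d (\<lambda>i. \<Sum>j<d. A (i, j) * x j) \<le> m\<^sup>2 * sqnorm d x"
proof -
  define y where "y = (\<lambda>i. \<Sum>j<d. A (i, j) * x j)"
  have "sqnorm d y = bilin d A y x"
    unfolding sqnorm_def bilin_def power2_eq_square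
    by (intro sum.cong refl) (simp add: y_def sum_distrib_left mult_ac)
  also have "\<dots> \<le> m / 2 * (1 / m * sqnorm d y + sqnorm d x / (1 / m))"
    using abs_bilin_le_quad_bound[OF A m, of "1 / m" y x] \<open>m > 0\<close> by simp
  also have "\<dots> = sqnorm d y / 2 + m\<^sup>2 * sqnorm d x / 2"
    using \<open>m > 0\<close> by (simp add: field_simps power2_eq_square)
  finally show ?thesis by (simp add: y_def)
qed

lemma frobenius_le_quad_bound:
  assumes A: "symmetric_matrix d A" and m: "\<And>x. \<bar>quad d A x\<bar> \<le> m * sqnorm d x" and "m > 0"
  shows "(\<Sum>p\<in>{..<d} \<times> {..<d}. (A p)\<^sup>2) \<le> m\<^sup>2 * real d"
proof -
  have "(\<Sum>i<d. (A (i, j))\<^sup>2) \<le> m\<^sup>2" if "j < d" for j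
  proof -
    have "(\<Sum>k<d. A (i, k) * of_bool (k = j)) = A (i, j)" for i
      using that by simp
    moreover have "sqnorm d (\<lambda>k. of_bool (k = j)) = 1"
      using that by (simp add: sqnorm_def of_bool_def if_distrib[of "\<lambda>x. x\<^sup>2"] cong: if_cong)
    ultimately show ?thesis
      using sqnorm_image_le_quad_bound[OF A m \<open>m > 0\<close>, of "\<lambda>k. of_bool (k = j)"]
      by (simp add: sqnorm_def)
  qed
  then have "(\<Sum>j<d. \<Sum>i<d. (A (i, j))\<^sup>2) \<le> (\<Sum>j<d. m\<^sup>2)"
    by (intro sum_mono) simp
  moreover have "(\<Sum>p\<in>{..<d} \<times> {..<d}. (A p)\<^sup>2) = (\<Sum>i<d. \<Sum>j<d. (A (i, j))\<^sup>2)"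
    by (simp add: sum.cartesian_product split_beta)
  moreover have "(\<Sum>i<d. \<Sum>j<d. (A (i, j))\<^sup>2) = (\<Sum>j<d. \<Sum>i<d. (A (i, j))\<^sup>2)"
    by (rule sum.swap)
  ultimately show ?thesis by (simp add: mult.commute)
qed

lemma op_norm_le_quad_bound:
  assumes A: "symmetric_matrix d A" and m: "\<And>x. \<bar>quad d A x\<bar> \<le> m * sqnorm d x" and "m > 0"
  shows "op_norm d A \<le> m"
  unfolding op_norm_def
proof (rule cSUP_least)
  have "(\<lambda>_. 0) \<in> {x. L2_set x {..<d} \<le> 1}" by (simp add: L2_set_def)
  then show "{x. L2_set x {..<d} \<le> 1} \<noteq> {}" by blast
next
  fix x assume "x \<in> {x. L2_set x {..<d} \<le> 1}"
  then have "sqnorm d x \<le> 1" by (simp add: L2_set_def sqnorm_def)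
  then have "sqnorm d (\<lambda>i. \<Sum>j<d. A (i, j) * x j) \<le> m\<^sup>2"
    using sqnorm_image_le_quad_bound[OF A m \<open>m > 0\<close>, of x] \<open>m > 0\<close>
    by (smt (verit) mult_left_le zero_le_power2 mult.commute)
  then show "L2_set (\<lambda>i. \<Sum>j<d. A (i, j) * x j) {..<d} \<le> m"
    using \<open>m > 0\<close> by (auto simp: L2_set_def sqnorm_def intro: real_le_lsqrt sum_nonneg)
qed

section \<open>Rounding a symmetric matrix to a lattice matrix\<close>

definition upper_triangle :: "nat \<Rightarrow> (nat \<times> nat) set" where
  "upper_triangle d = {(i, j). i \<le> j \<and> j < d}"

text \<open>
  How often the entry at a position of the upper triangle occurs in the full symmetric matrix.
\<close>

definition entry_weight :: "nat \<times> nat \<Rightarrow> real" where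
  "entry_weight p = (if fst p = snd p then 1 else 2)"

lemma upper_triangle_subset: "upper_triangle d \<subseteq> {..<d} \<times> {..<d}"
  by (auto simp: upper_triangle_def)

lemma finite_upper_triangle [simp]: "finite (upper_triangle d)"
  using upper_triangle_subset by (rule finite_subset) simp

lemma card_upper_triangle_le: "real (card (upper_triangle d)) \<le> (real d)\<^sup>2"
  using card_mono[OF _ upper_triangle_subset[of d]] by (simp add: power2_eq_square flip: of_nat_mult)

lemma sum_symmetric_eq_upper_triangle:
  fixes g :: "nat \<times> nat \<Rightarrow> real"
  assumes "\<And>i j. i < d \<Longrightarrow> j < d \<Longrightarrow> g (i, j) = g (j, i)"
  shows "(\<Sum>i<d. \<Sum>j<d. g (i, j)) = (\<Sum>p\<in>upper_triangle d. entry_weight p * g p)"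
  using assms
proof (induction d)
  case 0
  then show ?case by (simp add: upper_triangle_def)
next
  case (Suc d)
  let ?C = "(\<lambda>i. (i, d)) ` {..<d}"
  have split: "upper_triangle (Suc d) = upper_triangle d \<union> insert (d, d) ?C"
    by (auto simp: upper_triangle_def less_Suc_eq)
  have disjoint: "upper_triangle d \<inter> insert (d, d) ?C = {}" "(d, d) \<notin> ?C"
    by (auto simp: upper_triangle_def)
  have column: "(\<Sum>p\<in>?C. entry_weight p * g p) = 2 * (\<Sum>i<d. g (i, d))"
    by (subst sum.reindex) (auto simp: inj_on_def entry_weight_def sum_distrib_left intro!: sum.cong)
  have "(\<Sum>p\<in>upper_triangle (Suc d). entry_weight p * g p)
      = (\<Sum>p\<in>upper_triangle d. entry_weight p * g p) + (\<Sum>p\<in>insert (d, d) ?C. entry_weight p * g p)"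
    unfolding split using disjoint by (intro sum.union_disjoint) auto
  also have "(\<Sum>p\<in>insert (d, d) ?C. entry_weight p * g p) = g (d, d) + 2 * (\<Sum>i<d. g (i, d))"
    using disjoint(2) column by (subst sum.insert) (auto simp: entry_weight_def)
  finally have "(\<Sum>p\<in>upper_triangle (Suc d). entry_weight p * g p)
      = (\<Sum>p\<in>upper_triangle d. entry_weight p * g p) + (g (d, d) + 2 * (\<Sum>i<d. g (i, d)))" .
  moreover have "(\<Sum>i<Suc d. \<Sum>j<Suc d. g (i, j))
      = (\<Sum>i<d. \<Sum>j<d. g (i, j)) + (\<Sum>i<d. g (i, d)) + (\<Sum>i<d. g (d, i)) + g (d, d)"
    by (simp add: sum.distrib)
  moreover have "(\<Sum>i<d. g (d, i)) = (\<Sum>i<d. g (i, d))"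
    using Suc.prems by (intro sum.cong) auto
  ultimately show ?case using Suc by simp
qed

lemma quad_eq_upper_triangle:
  assumes "symmetric_matrix d A"
  shows "quad d A u = (\<Sum>p\<in>upper_triangle d. entry_weight p * u (fst p) * u (snd p) * A p)"
  using sum_symmetric_eq_upper_triangle[of d "\<lambda>(i, j). A (i, j) * u i * u j"] assms
  by (simp add: bilin_def symmetric_matrix_def split_beta mult_ac)

text \<open>
  Up to the factor \<open>1 / d\<close>, the left-hand side is the variance of \<open>u \<bullet> A u\<close> for a GOE matrix \<open>A\<close>. The
  doubled variance on the diagonal is what makes it rotation invariant.
\<close>

lemma sum_upper_triangle_coeff_le:
  "(\<Sum>p\<in>upper_triangle d. (1 + of_bool (fst p = snd p)) * (entry_weight p * u (fst p) * u (snd p))\<^sup>2)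
     = 2 * (sqnorm d u)\<^sup>2"
proof -
  have "(sqnorm d u)\<^sup>2 = (\<Sum>i<d. \<Sum>j<d. (u i)\<^sup>2 * (u j)\<^sup>2)"
    by (simp add: sqnorm_def power2_eq_square[of "sum _ _"] sum_product)
  also have "\<dots> = (\<Sum>p\<in>upper_triangle d. entry_weight p * ((u (fst p))\<^sup>2 * (u (snd p))\<^sup>2))"
    using sum_symmetric_eq_upper_triangle[of d "\<lambda>(i, j). (u i)\<^sup>2 * (u j)\<^sup>2"]
    by (simp add: split_beta mult.commute)
  finally show ?thesis
    by (auto simp: sum_distrib_left entry_weight_def power_mult_distrib intro!: sum.cong)
qed

text \<open>
  Every entry is rounded down or up. The rounding errors can be chosen like independent centred
  variables, which is why their quadratic forms are of order \<open>sqrt d\<close> instead of \<open>d\<close>. Only the upper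
  triangle is recorded, so that the number of coordinates stays below \<open>d\<^sup>2\<close>.
\<close>

lemma exists_lattice_matrix_near:
  assumes "d > 0" and A: "symmetric_matrix d A" and "h > 0"
  shows "\<exists>Z \<in> upper_triangle d \<rightarrow>\<^sub>E (UNIV :: int set).
    (\<forall>p\<in>upper_triangle d. \<bar>A p / h - real_of_int (Z p)\<bar> \<le> 1) \<and>
    (\<forall>u\<in>sphere_net d. \<bar>quad d A u
       - h * (\<Sum>p\<in>upper_triangle d. entry_weight p * u (fst p) * u (snd p) * real_of_int (Z p))\<bar>
         \<le> 20 * h * sqrt (real d))"
proof -
  define c where "c = (\<lambda>(u :: nat \<Rightarrow> real) p. entry_weight p * u (fst p) * u (snd p))"
  have c: "(\<Sum>p\<in>upper_triangle d. (c u p)\<^sup>2) \<le> 2" if "u \<in> sphere_net d" for u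
  proof -
    have "(\<Sum>p\<in>upper_triangle d. (c u p)\<^sup>2)
        \<le> (\<Sum>p\<in>upper_triangle d. (1 + of_bool (fst p = snd p)) * (c u p)\<^sup>2)"
      by (intro sum_mono) auto
    also have "\<dots> = 2 * (sqnorm d u)\<^sup>2"
      unfolding c_def by (rule sum_upper_triangle_coeff_le)
    also have "\<dots> \<le> 2"
      using sqnorm_sphere_net_le[OF that] by (simp add: abs_square_le_1)
    finally show ?thesis .
  qed
  \<comment> \<open>Rounding lemma with \<open>V = 2\<close>, \<open>L = 18 * d\<close> (the size of the net), and \<open>\<theta> = sqrt d\<close>, which balances its two error terms.\<close>
  have "\<exists>b\<in>upper_triangle d \<rightarrow> {0, 1}. \<forall>u\<in>sphere_net d.
      \<bar>\<Sum>p\<in>upper_triangle d. c u p * (b p - frac (A p / h))\<bar>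
        \<le> sqrt (real d) * 2 / 8 + (18 * real d + 1) / sqrt (real d)"
    using \<open>d > 0\<close> frac_ge_0 less_imp_le[OF frac_lt_1]
    by (intro exists_rounding_uniformly_close finite_sphere_net card_sphere_net_le c) auto
  then obtain b where b: "b \<in> upper_triangle d \<rightarrow> {0, 1}"
    and bc: "\<And>u. u \<in> sphere_net d \<Longrightarrow> \<bar>\<Sum>p\<in>upper_triangle d. c u p * (b p - frac (A p / h))\<bar>
        \<le> sqrt (real d) * 2 / 8 + (18 * real d + 1) / sqrt (real d)"
    by blast
  define Z where "Z = (\<lambda>p\<in>upper_triangle d. \<lfloor>A p / h\<rfloor> + \<lfloor>b p\<rfloor>)"
  have Z: "real_of_int (Z p) = A p / h + (b p - frac (A p / h))" if "p \<in> upper_triangle d" for p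
  proof -
    have "b p \<in> {0, 1}" using b that by blast
    then show ?thesis using that by (auto simp: Z_def frac_def)
  qed
  show ?thesis
  proof (intro bexI[of _ Z] conjI ballI)
    fix p assume p: "p \<in> upper_triangle d"
    then have "b p \<in> {0, 1}" using b by blast
    then show "\<bar>A p / h - real_of_int (Z p)\<bar> \<le> 1"
      using Z[OF p] frac_ge_0[of "A p / h"] frac_lt_1[of "A p / h"] by auto
  next
    fix u assume u: "u \<in> sphere_net d"
    have "quad d A u - h * (\<Sum>p\<in>upper_triangle d. entry_weight p * u (fst p) * u (snd p) * real_of_int (Z p))
        = (\<Sum>p\<in>upper_triangle d. - (h * (c u p * (b p - frac (A p / h)))))"
      unfolding quad_eq_upper_triangle[OF A] sum_distrib_left sum_subtractf[symmetric]
      using \<open>h > 0\<close> by (intro sum.cong refl) (simp add: Z c_def algebra_simps)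
    then have "\<bar>quad d A u - h * (\<Sum>p\<in>upper_triangle d. entry_weight p * u (fst p) * u (snd p) * real_of_int (Z p))\<bar>
        = h * \<bar>\<Sum>p\<in>upper_triangle d. c u p * (b p - frac (A p / h))\<bar>"
      using \<open>h > 0\<close> by (simp add: sum_negf abs_mult flip: sum_distrib_left)
    also have "\<dots> \<le> h * (20 * sqrt (real d))"
    proof (rule mult_left_mono)
      have "(18 * real d + 1) / sqrt (real d) \<le> (19 * real d) / sqrt (real d)"
        using \<open>d > 0\<close> by (intro divide_right_mono) auto
      also have "\<dots> = 19 * sqrt (real d)"
        by (simp add: real_div_sqrt flip: times_divide_eq_right)
      finally show "\<bar>\<Sum>p\<in>upper_triangle d. c u p * (b p - frac (A p / h))\<bar> \<le> 20 * sqrt (real d)"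
        using bc[OF u] real_sqrt_ge_zero[of "real d"] by simp
    qed (use \<open>h > 0\<close> in simp)
    finally show "\<bar>quad d A u - h * (\<Sum>p\<in>upper_triangle d. entry_weight p * u (fst p) * u (snd p) * real_of_int (Z p))\<bar>
        \<le> 20 * h * sqrt (real d)" by (simp add: mult_ac)
  qed (simp add: Z_def)
qed

section \<open>Partial colouring\<close>

lemma bilin_sum_matrix:
  "bilin d (\<lambda>p. \<Sum>i\<in>S. c i * A i p) x y = (\<Sum>i\<in>S. c i * bilin d (A i) x y)"
proof -
  have "bilin d (\<lambda>p. \<Sum>i\<in>S. c i * A i p) x y
      = (\<Sum>j<d. \<Sum>k<d. \<Sum>i\<in>S. c i * (A i (j, k) * x j * y k))"
    by (simp add: bilin_def sum_distrib_right mult.assoc)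
  also have "\<dots> = (\<Sum>j<d. \<Sum>i\<in>S. \<Sum>k<d. c i * (A i (j, k) * x j * y k))"
    by (intro sum.cong refl sum.swap)
  also have "\<dots> = (\<Sum>i\<in>S. \<Sum>j<d. \<Sum>k<d. c i * (A i (j, k) * x j * y k))"
    by (rule sum.swap)
  finally show ?thesis by (simp add: bilin_def sum_distrib_left)
qed

lemma symmetric_sum_matrix:
  "(\<And>i. i \<in> S \<Longrightarrow> symmetric_matrix d (A i)) \<Longrightarrow> symmetric_matrix d (\<lambda>p. \<Sum>i\<in>S. c i * A i p)"
  by (auto simp: symmetric_matrix_def intro!: sum.cong)

text \<open>
  The entries of the lattice matrix differ from those of \<open>A / h\<close> by at most \<open>1\<close>, which contributes no
  more than the dimension.
\<close>

lemma sum_lattice_matrix_square_le: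
  assumes Z: "\<And>p. p \<in> upper_triangle d \<Longrightarrow> \<bar>A p / h - real_of_int (Z p)\<bar> \<le> 1"
    and A: "(\<Sum>p\<in>{..<d} \<times> {..<d}. (A p)\<^sup>2) \<le> B" and "h > 0"
  shows "(\<Sum>p\<in>upper_triangle d. (real_of_int (Z p))\<^sup>2) \<le> 2 * B / h\<^sup>2 + 2 * (real d)\<^sup>2"
proof -
  have "(\<Sum>p\<in>upper_triangle d. (real_of_int (Z p))\<^sup>2) \<le> (\<Sum>p\<in>upper_triangle d. 2 / h\<^sup>2 * (A p)\<^sup>2 + 2)"
  proof (rule sum_mono)
    fix p assume p: "p \<in> upper_triangle d"
    define e where "e = real_of_int (Z p) - A p / h"
    have "e\<^sup>2 \<le> 1"
      using Z[OF p] by (simp add: e_def abs_square_le_1 abs_minus_commute)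
    have "(real_of_int (Z p))\<^sup>2 = (A p / h + e)\<^sup>2"
      by (simp add: e_def)
    also have "\<dots> \<le> 2 * (A p / h)\<^sup>2 + 2 * e\<^sup>2"
      using sum_squares_bound[of "A p / h" e] by (simp add: power2_sum)
    also have "\<dots> \<le> 2 / h\<^sup>2 * (A p)\<^sup>2 + 2"
      using \<open>e\<^sup>2 \<le> 1\<close> by (simp add: power_divide)
    finally show "(real_of_int (Z p))\<^sup>2 \<le> 2 / h\<^sup>2 * (A p)\<^sup>2 + 2" .
  qed
  also have "\<dots> = 2 / h\<^sup>2 * (\<Sum>p\<in>upper_triangle d. (A p)\<^sup>2) + 2 * real (card (upper_triangle d))"
    by (simp add: sum.distrib sum_distrib_left)
  also have "\<dots> \<le> 2 / h\<^sup>2 * B + 2 * (real d)\<^sup>2"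
  proof (intro add_mono mult_left_mono card_upper_triangle_le)
    have "(\<Sum>p\<in>upper_triangle d. (A p)\<^sup>2) \<le> (\<Sum>p\<in>{..<d} \<times> {..<d}. (A p)\<^sup>2)"
      by (intro sum_mono2 upper_triangle_subset) auto
    then show "(\<Sum>p\<in>upper_triangle d. (A p)\<^sup>2) \<le> B" using A by linarith
  qed auto
  finally show ?thesis by simp
qed

text \<open>
  Round the matrix of every balanced signing to a lattice matrix. There are so few lattice matrices
  that two signings far apart share one, and half their difference is the partial colouring.
\<close>

lemma exists_partial_colouring:
  assumes "d > 0" and S: "finite S" and W: "\<And>i. i \<in> S \<Longrightarrow> symmetric_matrix d (W i)"
    and V: "\<And>u. u \<in> sphere_net d \<Longrightarrow> (\<Sum>i\<in>S. (quad d (W i) u)\<^sup>2) \<le> V" "V > 0" and "h > 0"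
    and large: "4 * (320 * V * (real d)\<^sup>2 / h\<^sup>2 + 4 * (real d)\<^sup>2 + 1) \<le> real (card S)"
  shows "\<exists>x \<in> S \<rightarrow> {-1, 0, 1}. card S \<le> 8 * card {i \<in> S. x i \<noteq> 0} \<and>
    (\<forall>u\<in>sphere_net d. \<bar>\<Sum>i\<in>S. x i * quad d (W i) u\<bar> \<le> 20 * h * sqrt (real d))"
proof -
  define A where "A \<epsilon> p = (\<Sum>i\<in>S. \<epsilon> i * W i p)" for \<epsilon> p
  have A_sym: "symmetric_matrix d (A \<epsilon>)" for \<epsilon>
    unfolding A_def by (rule symmetric_sum_matrix[OF W])
  have A_quad: "quad d (A \<epsilon>) u = (\<Sum>i\<in>S. \<epsilon> i * quad d (W i) u)" for \<epsilon> u
    unfolding A_def by (rule bilin_sum_matrix)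
  \<comment> \<open>Large enough for a union bound over the net: \<open>2 * V * (18 * d + 2) \<le> 40 * V * d\<close>.\<close>
  define t where "t = sqrt (40 * V * real d)"
  have "t > 0" using \<open>V > 0\<close> \<open>d > 0\<close> by (simp add: t_def)
  have t2: "t\<^sup>2 = 40 * V * real d" using \<open>V > 0\<close> by (simp add: t_def)
  define G where "G = {\<epsilon> \<in> signings S. \<forall>u\<in>sphere_net d. \<bar>\<Sum>i\<in>S. \<epsilon> i * quad d (W i) u\<bar> \<le> t}"
  have card_G: "2 ^ card S \<le> 2 * real (card G)"
    unfolding G_def
  proof (rule card_balanced_signings_ge[OF S finite_sphere_net card_sphere_net_le V \<open>t > 0\<close>])
    have "2 * V * (18 * real d + 2) \<le> 2 * V * (20 * real d)"
      using \<open>V > 0\<close> \<open>d > 0\<close> by (intro mult_left_mono) auto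
    then show "2 * V * (18 * real d + 2) \<le> t\<^sup>2" by (simp add: t2)
  qed
  define lattice_sum where "lattice_sum Z u =
      (\<Sum>p\<in>upper_triangle d. entry_weight p * u (fst p) * u (snd p) * real_of_int (Z p))"
    for Z :: "nat \<times> nat \<Rightarrow> int" and u
  have "\<forall>\<epsilon>. \<exists>Z \<in> upper_triangle d \<rightarrow>\<^sub>E (UNIV :: int set).
      (\<forall>p\<in>upper_triangle d. \<bar>A \<epsilon> p / h - real_of_int (Z p)\<bar> \<le> 1) \<and>
      (\<forall>u\<in>sphere_net d. \<bar>quad d (A \<epsilon>) u - h * lattice_sum Z u\<bar> \<le> 20 * h * sqrt (real d))"
    unfolding lattice_sum_def using exists_lattice_matrix_near[OF \<open>d > 0\<close> A_sym \<open>h > 0\<close>] by blast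
  then obtain \<Phi> where \<Phi>: "\<Phi> \<epsilon> \<in> upper_triangle d \<rightarrow>\<^sub>E (UNIV :: int set)"
      "\<And>p. p \<in> upper_triangle d \<Longrightarrow> \<bar>A \<epsilon> p / h - real_of_int (\<Phi> \<epsilon> p)\<bar> \<le> 1"
      "\<And>u. u \<in> sphere_net d \<Longrightarrow> \<bar>quad d (A \<epsilon>) u - h * lattice_sum (\<Phi> \<epsilon>) u\<bar> \<le> 20 * h * sqrt (real d)"
    for \<epsilon> by metis
  define T where "T = 320 * V * (real d)\<^sup>2 / h\<^sup>2 + 2 * (real d)\<^sup>2"
  define F where "F = {z \<in> upper_triangle d \<rightarrow>\<^sub>E (UNIV :: int set).
      (\<Sum>p\<in>upper_triangle d. (real_of_int (z p))\<^sup>2) \<le> T}"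
  have "\<Phi> ` G \<subseteq> F"
  proof (rule image_subsetI)
    fix \<epsilon> assume \<epsilon>: "\<epsilon> \<in> G"
    have "\<bar>quad d (A \<epsilon>) x\<bar> \<le> 2 * t * sqnorm d x" for x
      by (rule abs_quad_le_of_sphere_net[OF \<open>d > 0\<close> A_sym]) (use \<epsilon> in \<open>simp add: G_def A_quad\<close>)
    then have "(\<Sum>p\<in>{..<d} \<times> {..<d}. (A \<epsilon> p)\<^sup>2) \<le> (2 * t)\<^sup>2 * real d"
      using \<open>t > 0\<close> by (intro frobenius_le_quad_bound A_sym) auto
    also have "\<dots> = 160 * V * (real d)\<^sup>2"
      unfolding power_mult_distrib t2 by (simp add: power2_eq_square)
    finally have "(\<Sum>p\<in>upper_triangle d. (real_of_int (\<Phi> \<epsilon> p))\<^sup>2) \<le> T"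
      using sum_lattice_matrix_square_le[OF \<Phi>(2) _ \<open>h > 0\<close>] by (fastforce simp: T_def)
    then show "\<Phi> \<epsilon> \<in> F" using \<Phi>(1) by (simp add: F_def)
  qed
  moreover have "(3 / 2) ^ card S * real (card F) < real (card G)"
  proof -
    have "real (card F) \<le> exp T * 3 ^ card (upper_triangle d)"
      unfolding F_def by (rule card_lattice_points_in_ball_le) simp
    also have "\<dots> \<le> exp T * exp (2 * (real d)\<^sup>2)"
    proof (rule mult_left_mono)
      have "(3::real) ^ card (upper_triangle d) \<le> exp 2 ^ card (upper_triangle d)"
        using exp_ge_add_one_self[of 2] by (intro power_mono) auto
      also have "\<dots> = exp (2 * real (card (upper_triangle d)))"
        by (simp add: exp_of_nat_mult[symmetric] mult.commute)
      finally show "(3::real) ^ card (upper_triangle d) \<le> exp (2 * (real d)\<^sup>2)"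
        using card_upper_triangle_le[of d] by (meson exp_le_cancel_iff mult_left_mono order_trans zero_le_numeral)
    qed simp
    finally have F: "real (card F) \<le> exp (T + 2 * (real d)\<^sup>2)" by (simp add: exp_add)
    have "exp (1 / 4) \<le> (4 / 3 :: real)"
    proof (rule power_le_imp_le_base[of _ 3])
      have "exp (1 / 4 :: real) ^ 4 \<le> 3"
        using exp_le by (simp flip: exp_of_nat_mult)
      then show "exp (1 / 4 :: real) ^ Suc 3 \<le> (4 / 3) ^ Suc 3"
        by (simp add: eval_nat_numeral)
    qed simp
    have "2 * real (card F) < exp 1 * exp (T + 2 * (real d)\<^sup>2)"
    proof -
      have "2 < exp (1::real)" using exp_lower_Taylor_quadratic[of "1::real"] by simp
      then have "2 * exp (T + 2 * (real d)\<^sup>2) < exp 1 * exp (T + 2 * (real d)\<^sup>2)"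
        by (intro mult_strict_right_mono) auto
      then show ?thesis using F by linarith
    qed
    also have "\<dots> \<le> exp (real (card S) / 4)"
      using large by (simp add: T_def field_simps flip: exp_add)
    also have "\<dots> = exp (1 / 4) ^ card S"
      by (simp flip: exp_of_nat_mult)
    also have "\<dots> \<le> (4 / 3) ^ card S"
      using \<open>exp (1 / 4) \<le> 4 / 3\<close> by (intro power_mono) auto
    finally have "(3 / 2) ^ card S * (2 * real (card F)) < (3 / 2) ^ card S * (4 / 3) ^ card S"
      by (intro mult_strict_left_mono) auto
    also have "\<dots> = 2 ^ card S" by (simp flip: power_mult_distrib)
    finally show ?thesis using card_G by linarith
  qed
  ultimately obtain \<epsilon> \<delta> where \<epsilon>\<delta>: "\<epsilon> \<in> G" "\<delta> \<in> G" "\<Phi> \<epsilon> = \<Phi> \<delta>" "card S < 8 * card {i \<in> S. \<epsilon> i \<noteq> \<delta> i}"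
    using exists_distant_signings_in_fibre[OF S, of F \<Phi> G]
      card_lattice_points_in_ball_le(1)[OF finite_upper_triangle[of d], of T]
    by (auto simp: F_def G_def)
  define x where "x i = (\<epsilon> i - \<delta> i) / 2" for i
  have "x \<in> S \<rightarrow> {-1, 0, 1}"
  proof
    fix i assume "i \<in> S"
    then have "\<epsilon> i \<in> {-1, 1}" "\<delta> i \<in> {-1, 1}"
      using \<epsilon>\<delta> by (auto simp: G_def signings_def)
    then show "x i \<in> {-1, 0, 1}" by (auto simp: x_def)
  qed
  moreover have "{i \<in> S. x i \<noteq> 0} = {i \<in> S. \<epsilon> i \<noteq> \<delta> i}"
    by (auto simp: x_def)
  moreover have "\<bar>\<Sum>i\<in>S. x i * quad d (W i) u\<bar> \<le> 20 * h * sqrt (real d)" if "u \<in> sphere_net d" for u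
  proof -
    have "(\<Sum>i\<in>S. x i * quad d (W i) u) = (quad d (A \<epsilon>) u - quad d (A \<delta>) u) / 2"
      unfolding A_quad sum_subtractf[symmetric] sum_divide_distrib
      by (intro sum.cong) (auto simp: x_def algebra_simps diff_divide_distrib)
    then show ?thesis
      using \<Phi>(3)[OF that, of \<epsilon>] \<Phi>(3)[OF that, of \<delta>] \<epsilon>\<delta>(3) by (simp add: abs_if split: if_splits)
  qed
  ultimately show ?thesis using \<epsilon>\<delta>(4) by (intro bexI[of _ x]) auto
qed

text \<open>
  With \<open>S\<close> the whole index set the bound is of order \<open>n / d\<close>; for small sets \<open>S\<close> it approaches
  \<open>\<beta> * n / d\<close>, where \<open>\<beta>\<close> can be made small at the price of a large \<open>M\<close>. A single condition thus serves both
  the partial colourings and the final signs.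
\<close>

definition spread :: "nat \<Rightarrow> nat \<Rightarrow> real \<Rightarrow> real \<Rightarrow> (nat \<Rightarrow> nat \<times> nat \<Rightarrow> real) \<Rightarrow> bool" where
  "spread d n \<beta> M W \<longleftrightarrow> (\<forall>u\<in>sphere_net d. \<forall>S\<subseteq>{..<n}.
     real d * (\<Sum>i\<in>S. (quad d (W i) u)\<^sup>2) \<le> M * real (card S) + \<beta> * real n)"

text \<open>
  Each round signs at least an eighth of the remaining indices and costs the same \<open>20 * \<delta> * sqrt n\<close>. The
  rounds stop early once at most \<open>\<eta> * n\<close> indices remain, because below that size there are too few
  signings for the pigeonhole principle.
\<close>

lemma exists_repeated_partial_colouring:
  assumes "d > 0" and W: "\<And>i. i < n \<Longrightarrow> symmetric_matrix d (W i)" and spread: "spread d n \<beta> M W"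
    and \<beta>: "0 < \<beta>" "\<beta> \<le> 1" and "0 \<le> M" and "0 < \<eta>" and "\<delta> > 0"
    and large: "4 * (320 * (M + 1) / \<delta>\<^sup>2 + 5) * (real d)\<^sup>2 \<le> \<eta> * real n"
  shows "\<exists>x \<in> {..<n} \<rightarrow> {-1, 0, 1}.
    real (card {i. i < n \<and> x i = 0}) \<le> max (\<eta> * real n) ((7 / 8) ^ k * real n) \<and>
    (\<forall>u\<in>sphere_net d. \<bar>\<Sum>i<n. x i * quad d (W i) u\<bar> \<le> real k * (20 * \<delta> * sqrt (real n)))"
proof (induction k)
  case 0
  show ?case by (intro bexI[of _ "\<lambda>_. 0"]) (auto simp: card_Collect_less_nat[of n, simplified])
next
  case (Suc k)
  then obtain x where x: "x \<in> {..<n} \<rightarrow> {-1, 0, 1}"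
    and card_x: "real (card {i. i < n \<and> x i = 0}) \<le> max (\<eta> * real n) ((7 / 8) ^ k * real n)"
    and x_le: "\<And>u. u \<in> sphere_net d \<Longrightarrow>
      \<bar>\<Sum>i<n. x i * quad d (W i) u\<bar> \<le> real k * (20 * \<delta> * sqrt (real n))"
    by blast
  define S where "S = {i. i < n \<and> x i = 0}"
  have S: "finite S" "S \<subseteq> {..<n}" by (auto simp: S_def)
  show ?case
  proof (cases "real (card S) \<le> \<eta> * real n")
    case True
    have "real k * (20 * \<delta> * sqrt (real n)) \<le> real (Suc k) * (20 * \<delta> * sqrt (real n))"
      using \<open>\<delta> > 0\<close> by (intro mult_right_mono) auto
    then show ?thesis
      using True x x_le by (intro bexI[of _ x]) (fastforce simp: S_def)+
  next
    case False
    have "0 < 4 * (320 * (M + 1) / \<delta>\<^sup>2 + 5) * (real d)\<^sup>2"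
      using \<open>0 \<le> M\<close> \<open>d > 0\<close> by (intro mult_pos_pos add_nonneg_pos) auto
    then have "n > 0" using large by (cases n) auto
    define V where "V = (M + 1) * real n / real d"
    \<comment> \<open>The mesh \<open>h\<close> is the largest for which the error \<open>20 * h * sqrt d\<close> is within the cost of a round.\<close>
    define h where "h = \<delta> * sqrt (real n) / sqrt (real d)"
    have h: "20 * h * sqrt (real d) = 20 * \<delta> * sqrt (real n)" "h > 0"
      using \<open>d > 0\<close> \<open>n > 0\<close> \<open>\<delta> > 0\<close> by (auto simp: h_def)
    have "V > 0" using \<open>d > 0\<close> \<open>n > 0\<close> \<open>0 \<le> M\<close> by (simp add: V_def)
    have VS: "(\<Sum>i\<in>S. (quad d (W i) u)\<^sup>2) \<le> V" if "u \<in> sphere_net d" for u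
    proof -
      have "card S \<le> n" using card_mono[OF _ S(2)] by simp
      have "real d * (\<Sum>i\<in>S. (quad d (W i) u)\<^sup>2) \<le> M * real (card S) + \<beta> * real n"
        using spread that S(2) by (auto simp: spread_def)
      also have "\<dots> \<le> M * real n + 1 * real n"
        using \<open>card S \<le> n\<close> \<open>0 \<le> M\<close> \<beta> by (intro add_mono mult_mono) auto
      finally show ?thesis using \<open>d > 0\<close> by (simp add: V_def field_simps)
    qed
    have "V * (real d)\<^sup>2 / h\<^sup>2 = (M + 1) * (real d)\<^sup>2 / \<delta>\<^sup>2"
      using \<open>d > 0\<close> \<open>n > 0\<close> \<open>\<delta> > 0\<close>
      by (simp add: V_def h_def power_mult_distrib power_divide field_simps)
    then have "4 * (320 * V * (real d)\<^sup>2 / h\<^sup>2 + 4 * (real d)\<^sup>2 + 1)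
        = 4 * (320 * ((M + 1) * (real d)\<^sup>2 / \<delta>\<^sup>2) + 4 * (real d)\<^sup>2 + 1)"
      by (simp add: mult.assoc)
    also have "\<dots> \<le> 4 * (320 * ((M + 1) * (real d)\<^sup>2 / \<delta>\<^sup>2) + 4 * (real d)\<^sup>2 + (real d)\<^sup>2)"
      using \<open>d > 0\<close> by simp
    also have "\<dots> = 4 * (320 * (M + 1) / \<delta>\<^sup>2 + 5) * (real d)\<^sup>2"
      by (simp add: algebra_simps)
    also have "\<dots> \<le> real (card S)" using large False by linarith
    finally have large_S: "4 * (320 * V * (real d)\<^sup>2 / h\<^sup>2 + 4 * (real d)\<^sup>2 + 1) \<le> real (card S)" .
    have "symmetric_matrix d (W i)" if "i \<in> S" for i
      using W that by (simp add: S_def)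
    then obtain y where y: "y \<in> S \<rightarrow> {-1, 0, 1}" "card S \<le> 8 * card {i \<in> S. y i \<noteq> 0}"
      and y_le: "\<And>u. u \<in> sphere_net d \<Longrightarrow> \<bar>\<Sum>i\<in>S. y i * quad d (W i) u\<bar> \<le> 20 * h * sqrt (real d)"
      using exists_partial_colouring[OF \<open>d > 0\<close> S(1) _ VS \<open>V > 0\<close> h(2) large_S] by blast
    define x' where "x' i = (if i \<in> S then y i else x i)" for i
    have x': "x' \<in> {..<n} \<rightarrow> {-1, 0, 1}" using x y(1) by (simp add: x'_def Pi_iff)
    have "card {i. i < n \<and> x' i = 0} + card {i \<in> S. y i \<noteq> 0} = card S"
    proof -
      have "{i. i < n \<and> x' i = 0} = {i \<in> S. y i = 0}" by (auto simp: x'_def S_def)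
      moreover have "card ({i \<in> S. y i = 0} \<union> {i \<in> S. y i \<noteq> 0}) = card {i \<in> S. y i = 0} + card {i \<in> S. y i \<noteq> 0}"
        using S(1) by (intro card_Un_disjoint) auto
      moreover have "{i \<in> S. y i = 0} \<union> {i \<in> S. y i \<noteq> 0} = S" by auto
      ultimately show ?thesis by simp
    qed
    then have "real (card {i. i < n \<and> x' i = 0}) \<le> 7 / 8 * real (card S)"
      using y(2) by linarith
    also have "\<dots> \<le> (7 / 8) ^ Suc k * real n"
      using card_x False by (simp add: S_def max_def split: if_splits)
    finally have card_x': "real (card {i. i < n \<and> x' i = 0}) \<le> max (\<eta> * real n) ((7 / 8) ^ Suc k * real n)"
      by simp
    have "\<bar>\<Sum>i<n. x' i * quad d (W i) u\<bar> \<le> real (Suc k) * (20 * \<delta> * sqrt (real n))"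
      if u: "u \<in> sphere_net d" for u
    proof -
      have "(\<Sum>i<n. x' i * quad d (W i) u)
          = (\<Sum>i<n. x i * quad d (W i) u) + (\<Sum>i<n. if i \<in> S then y i * quad d (W i) u else 0)"
        unfolding sum.distrib[symmetric] by (intro sum.cong) (auto simp: x'_def S_def)
      also have "(\<Sum>i<n. if i \<in> S then y i * quad d (W i) u else 0) = (\<Sum>i\<in>S. y i * quad d (W i) u)"
        using S(2) by (simp add: sum.If_cases Int_absorb1)
      finally show ?thesis
        using x_le[OF u] y_le[OF u] h(1) by (simp add: algebra_simps)
    qed
    with x' card_x' show ?thesis by blast
  qed
qed

text \<open>
  The \<open>k\<close> rounds cost \<open>20 * \<delta> * k * sqrt n\<close> on the net. The remaining set is so small that its sums of
  squares are at most \<open>2 * \<beta> * n / d\<close>, and signing it costs another \<open>sqrt (80 * \<beta> * n)\<close>. Passing from the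
  net to the operator norm doubles both.
\<close>

lemma exists_signing_of_small_op_norm:
  assumes "d > 0" and W: "\<And>i. i < n \<Longrightarrow> symmetric_matrix d (W i)" and spread: "spread d n \<beta> M W"
    and \<beta>: "0 < \<beta>" "\<beta> \<le> 1" and "0 \<le> M" and \<eta>: "0 < \<eta>" "\<eta> * M \<le> \<beta>" "(7 / 8) ^ k \<le> \<eta>" and "\<delta> > 0"
    and large: "4 * (320 * (M + 1) / \<delta>\<^sup>2 + 5) * (real d)\<^sup>2 \<le> \<eta> * real n"
  shows "\<exists>\<epsilon> \<in> {..<n} \<rightarrow> {-1, 1}. op_norm d (\<lambda>p. \<Sum>i<n. \<epsilon> i * W i p)
    \<le> (40 * \<delta> * real k + 2 * sqrt (80 * \<beta>)) * sqrt (real n)"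
proof -
  obtain x where x: "x \<in> {..<n} \<rightarrow> {-1, 0, 1}"
    and card_x: "real (card {i. i < n \<and> x i = 0}) \<le> max (\<eta> * real n) ((7 / 8) ^ k * real n)"
    and x_le: "\<And>u. u \<in> sphere_net d \<Longrightarrow>
      \<bar>\<Sum>i<n. x i * quad d (W i) u\<bar> \<le> real k * (20 * \<delta> * sqrt (real n))"
    using exists_repeated_partial_colouring[OF \<open>d > 0\<close> W spread \<beta> \<open>0 \<le> M\<close> \<eta>(1) \<open>\<delta> > 0\<close> large] by blast
  have "0 < 4 * (320 * (M + 1) / \<delta>\<^sup>2 + 5) * (real d)\<^sup>2"
    using \<open>0 \<le> M\<close> \<open>d > 0\<close> by (intro mult_pos_pos add_nonneg_pos) auto
  then have "n > 0" using large by (cases n) auto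
  define S where "S = {i. i < n \<and> x i = 0}"
  have S: "finite S" "S \<subseteq> {..<n}" by (auto simp: S_def)
  have card_S: "real (card S) \<le> \<eta> * real n"
    using card_x \<eta>(3) mult_right_mono[OF \<eta>(3), of "real n"] by (simp add: S_def)
  define V where "V = 2 * \<beta> * real n / real d"
  have "V > 0" using \<open>d > 0\<close> \<open>n > 0\<close> \<beta> by (simp add: V_def)
  have VS: "(\<Sum>i\<in>S. (quad d (W i) u)\<^sup>2) \<le> V" if "u \<in> sphere_net d" for u
  proof -
    have "real d * (\<Sum>i\<in>S. (quad d (W i) u)\<^sup>2) \<le> M * real (card S) + \<beta> * real n"
      using spread that S(2) by (auto simp: spread_def)
    also have "\<dots> \<le> M * (\<eta> * real n) + \<beta> * real n"
      using card_S \<open>0 \<le> M\<close> by (intro add_right_mono mult_left_mono)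
    also have "\<dots> \<le> \<beta> * real n + \<beta> * real n"
      using mult_right_mono[OF \<eta>(2), of "real n"] by (simp add: mult_ac)
    finally show ?thesis using \<open>d > 0\<close> by (simp add: V_def field_simps)
  qed
  define t where "t = sqrt (80 * \<beta> * real n)"
  have "t > 0" using \<open>n > 0\<close> \<beta> by (simp add: t_def)
  have "2 ^ card S \<le> 2 * real (card {\<epsilon> \<in> signings S. \<forall>u\<in>sphere_net d. \<bar>\<Sum>i\<in>S. \<epsilon> i * quad d (W i) u\<bar> \<le> t})"
  proof (rule card_balanced_signings_ge[OF S(1) finite_sphere_net card_sphere_net_le VS \<open>V > 0\<close> \<open>t > 0\<close>])
    have "2 * V * (18 * real d + 2) \<le> 2 * V * (20 * real d)"
      using \<open>V > 0\<close> \<open>d > 0\<close> by (intro mult_left_mono) auto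
    also have "\<dots> = t\<^sup>2" using \<open>d > 0\<close> \<beta> by (simp add: V_def t_def)
    finally show "2 * V * (18 * real d + 2) \<le> t\<^sup>2" .
  qed
  then have "0 < 2 * real (card {\<epsilon> \<in> signings S. \<forall>u\<in>sphere_net d. \<bar>\<Sum>i\<in>S. \<epsilon> i * quad d (W i) u\<bar> \<le> t})"
    by (rule less_le_trans[rotated]) simp
  then have "{\<epsilon> \<in> signings S. \<forall>u\<in>sphere_net d. \<bar>\<Sum>i\<in>S. \<epsilon> i * quad d (W i) u\<bar> \<le> t} \<noteq> {}"
    by (metis card.empty less_irrefl mult_zero_right of_nat_0)
  then obtain y where y: "y \<in> signings S"
    and y_le: "\<And>u. u \<in> sphere_net d \<Longrightarrow> \<bar>\<Sum>i\<in>S. y i * quad d (W i) u\<bar> \<le> t"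
    by blast
  define \<epsilon> where "\<epsilon> i = (if i \<in> S then y i else x i)" for i
  have \<epsilon>: "\<epsilon> \<in> {..<n} \<rightarrow> {-1, 1}"
  proof
    fix i assume "i \<in> {..<n}"
    then show "\<epsilon> i \<in> {-1, 1}"
      using x y by (cases "i \<in> S") (auto simp: \<epsilon>_def S_def signings_def PiE_iff Pi_iff)
  qed
  define b where "b = real k * (20 * \<delta> * sqrt (real n)) + t"
  have "b > 0" using \<open>t > 0\<close> \<open>\<delta> > 0\<close> by (simp add: b_def add_nonneg_pos)
  let ?A = "\<lambda>p. \<Sum>i<n. \<epsilon> i * W i p"
  have sym: "symmetric_matrix d ?A" using W by (intro symmetric_sum_matrix) auto
  have "\<bar>quad d ?A u\<bar> \<le> b" if u: "u \<in> sphere_net d" for u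
  proof -
    have "quad d ?A u = (\<Sum>i<n. \<epsilon> i * quad d (W i) u)" by (rule bilin_sum_matrix)
    also have "\<dots> = (\<Sum>i<n. x i * quad d (W i) u) + (\<Sum>i<n. if i \<in> S then y i * quad d (W i) u else 0)"
      unfolding sum.distrib[symmetric] by (intro sum.cong) (auto simp: \<epsilon>_def S_def)
    also have "(\<Sum>i<n. if i \<in> S then y i * quad d (W i) u else 0) = (\<Sum>i\<in>S. y i * quad d (W i) u)"
      using S(2) by (simp add: sum.If_cases Int_absorb1)
    finally show ?thesis using x_le[OF u] y_le[OF u] by (simp add: b_def)
  qed
  then have "\<bar>quad d ?A x\<bar> \<le> 2 * b * sqnorm d x" for x
    by (intro abs_quad_le_of_sphere_net \<open>d > 0\<close> sym)
  then have "op_norm d ?A \<le> 2 * b"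
    using \<open>b > 0\<close> by (intro op_norm_le_quad_bound sym) auto
  also have "\<dots> = (40 * \<delta> * real k + 2 * sqrt (80 * \<beta>)) * sqrt (real n)"
    by (simp add: b_def t_def real_sqrt_mult algebra_simps)
  finally show ?thesis using \<epsilon> by blast
qed

section \<open>Exponential moments of the GOE\<close>

lemma nn_integral_normal_density:
  assumes "\<sigma> > 0"
  shows "(\<integral>\<^sup>+x. ennreal (normal_density \<mu> \<sigma> x) \<partial>lborel) = 1"
  using assms by (subst nn_integral_eq_integral) auto

lemma nn_integral_exp_linear_normal:
  assumes "\<sigma> > 0"
  shows "(\<integral>\<^sup>+x. ennreal (exp (t * x)) \<partial>density lborel (normal_density 0 \<sigma>)) = ennreal (exp (t\<^sup>2 * \<sigma>\<^sup>2 / 2))"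
proof -
  have tilt: "normal_density 0 \<sigma> x * exp (t * x) = exp (t\<^sup>2 * \<sigma>\<^sup>2 / 2) * normal_density (t * \<sigma>\<^sup>2) \<sigma> x" for x
  proof -
    have "- (x\<^sup>2 / (2 * \<sigma>\<^sup>2)) + t * x = t\<^sup>2 * \<sigma>\<^sup>2 / 2 + - ((x - t * \<sigma>\<^sup>2)\<^sup>2 / (2 * \<sigma>\<^sup>2))"
      using assms by (simp add: field_simps power2_eq_square)
    then show ?thesis
      by (simp add: normal_density_def flip: exp_add)
  qed
  have "(\<integral>\<^sup>+x. ennreal (exp (t * x)) \<partial>density lborel (normal_density 0 \<sigma>))
      = (\<integral>\<^sup>+x. ennreal (exp (t\<^sup>2 * \<sigma>\<^sup>2 / 2)) * ennreal (normal_density (t * \<sigma>\<^sup>2) \<sigma> x) \<partial>lborel)"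
    by (subst nn_integral_density) (auto simp: tilt simp flip: ennreal_mult')
  also have "\<dots> = ennreal (exp (t\<^sup>2 * \<sigma>\<^sup>2 / 2))"
    using assms by (simp add: nn_integral_cmult nn_integral_normal_density)
  finally show ?thesis .
qed

lemma nn_integral_exp_square_std_normal:
  "(\<integral>\<^sup>+x. ennreal (exp (x\<^sup>2 / 4)) \<partial>density lborel std_normal_density) = ennreal (sqrt 2)"
proof -
  have widen: "std_normal_density x * exp (x\<^sup>2 / 4) = sqrt 2 * normal_density 0 (sqrt 2) x" for x
  proof -
    have "- (x\<^sup>2 / 2) + x\<^sup>2 / 4 = - (x\<^sup>2 / 4)" by simp
    then have "exp (- (x\<^sup>2 / 2)) * exp (x\<^sup>2 / 4) = exp (- (x\<^sup>2 / 4))"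
      by (simp flip: exp_add)
    then show ?thesis
      by (simp add: normal_density_def real_sqrt_mult field_simps)
  qed
  have "(\<integral>\<^sup>+x. ennreal (exp (x\<^sup>2 / 4)) \<partial>density lborel std_normal_density)
      = (\<integral>\<^sup>+x. ennreal (sqrt 2) * ennreal (normal_density 0 (sqrt 2) x) \<partial>lborel)"
    by (subst nn_integral_density) (auto simp: widen simp flip: ennreal_mult')
  also have "\<dots> = ennreal (sqrt 2)"
    by (simp add: nn_integral_cmult nn_integral_normal_density)
  finally show ?thesis .
qed

lemma GOE_entry_eq: "GOE_entry d p =
    density lborel (normal_density 0 (sqrt ((1 + of_bool (fst p = snd p)) / real d)))"
  by (simp add: GOE_entry_def split_beta)

lemma product_prob_space_GOE_entry:
  assumes "d > 0"
  shows "product_prob_space (GOE_entry d)"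
proof -
  have "prob_space (GOE_entry d p)" for p
    unfolding GOE_entry_eq using assms by (intro prob_space_normal_density) (auto simp: add_pos_nonneg)
  then show ?thesis by (rule product_prob_spaceI)
qed

lemma GOE_alt: "GOE d = distr (Pi\<^sub>M (upper_triangle d) (GOE_entry d)) (matrix_algebra d)
     (\<lambda>g. \<lambda>(i, j)\<in>{..<d} \<times> {..<d}. g (min i j, max i j))"
  by (simp add: GOE_def upper_triangle_def)

lemma sets_GOE [measurable_cong]: "sets (GOE d) = sets (matrix_algebra d)"
  by (simp add: GOE_alt)

lemma symmetrize_measurable:
  "(\<lambda>g. \<lambda>(i, j)\<in>{..<d} \<times> {..<d}. g (min i j, max i j))
     \<in> measurable (Pi\<^sub>M (upper_triangle d) (GOE_entry d)) (matrix_algebra d)"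
  unfolding matrix_algebra_def
proof (rule measurable_restrict, clarify)
  fix i j assume "i < d" "j < d"
  then have "(min i j, max i j) \<in> upper_triangle d" by (auto simp: upper_triangle_def)
  then have "(\<lambda>g. g (min i j, max i j)) \<in> measurable (Pi\<^sub>M (upper_triangle d) (GOE_entry d)) (GOE_entry d (min i j, max i j))"
    by (rule measurable_component_singleton)
  then show "(\<lambda>g. g (min i j, max i j)) \<in> borel_measurable (Pi\<^sub>M (upper_triangle d) (GOE_entry d))"
    by (simp add: GOE_entry_eq cong: measurable_cong_sets)
qed

lemma prob_space_GOE:
  assumes "d > 0"
  shows "prob_space (GOE d)"
proof -
  interpret product_prob_space "GOE_entry d" "upper_triangle d"
    using assms by (rule product_prob_space_GOE_entry)
  show ?thesis unfolding GOE_alt by (rule prob_space_distr[OF symmetrize_measurable])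
qed

lemma entry_measurable:
  "i < d \<Longrightarrow> j < d \<Longrightarrow> (\<lambda>A. A (i, j)) \<in> borel_measurable (matrix_algebra d)"
  unfolding matrix_algebra_def by (rule measurable_component_singleton) simp

lemma quad_measurable: "(\<lambda>A. quad d A u) \<in> borel_measurable (matrix_algebra d)"
  unfolding bilin_def
  by (intro borel_measurable_sum borel_measurable_times entry_measurable borel_measurable_const) auto

lemma AE_GOE_symmetric: "AE A in GOE d. symmetric_matrix d A"
proof -
  have "{A \<in> space (matrix_algebra d). \<forall>i\<in>{..<d}. \<forall>j\<in>{..<d}. A (i, j) = A (j, i)} \<in> sets (matrix_algebra d)"
    by (intro sets.sets_Collect_finite_All borel_measurable_eq entry_measurable) auto
  moreover have "symmetric_matrix d A \<longleftrightarrow> (\<forall>i\<in>{..<d}. \<forall>j\<in>{..<d}. A (i, j) = A (j, i))" for A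
    unfolding symmetric_matrix_def by blast
  ultimately have "{A \<in> space (matrix_algebra d). symmetric_matrix d A} \<in> sets (matrix_algebra d)"
    by (simp only:)
  moreover have "symmetric_matrix d (\<lambda>(i, j)\<in>{..<d} \<times> {..<d}. g (min i j, max i j))" for g
    unfolding symmetric_matrix_def by (simp add: min.commute max.commute)
  ultimately show ?thesis
    unfolding GOE_alt by (subst AE_distr_iff[OF symmetrize_measurable]) (simp_all only: AE_I2)
qed

lemma quad_symmetrized:
  "quad d (\<lambda>(i, j)\<in>{..<d} \<times> {..<d}. g (min i j, max i j)) u
    = (\<Sum>p\<in>upper_triangle d. entry_weight p * u (fst p) * u (snd p) * g p)"
  (is "quad d ?A u = _")
proof -
  have "symmetric_matrix d ?A" by (simp add: symmetric_matrix_def min.commute max.commute)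
  then have "quad d ?A u = (\<Sum>p\<in>upper_triangle d. entry_weight p * u (fst p) * u (snd p) * ?A p)"
    by (rule quad_eq_upper_triangle)
  also have "\<dots> = (\<Sum>p\<in>upper_triangle d. entry_weight p * u (fst p) * u (snd p) * g p)"
    by (intro sum.cong) (auto simp: upper_triangle_def min_def max_def)
  finally show ?thesis .
qed

text \<open>
  The form \<open>u \<bullet> A u\<close> is a centred Gaussian variable of variance at most \<open>2 / d\<close>, so \<open>1 / 8\<close> is half the
  critical exponent. Since \<open>exp (a\<^sup>2 / 2)\<close> is the mean of \<open>exp (a * z)\<close> over a standard
  Gaussian \<open>z\<close>, the exponent can be made linear in the independent entries, and after exchanging the
  integrals everything factorizes.
\<close>

lemma nn_integral_exp_quad_GOE_le:
  assumes "d > 0" and u: "sqnorm d u \<le> 1"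
  shows "(\<integral>\<^sup>+A. ennreal (exp (real d * (quad d A u)\<^sup>2 / 8)) \<partial>GOE d) \<le> ennreal 2"
proof -
  interpret product_prob_space "GOE_entry d" "upper_triangle d"
    using assms(1) by (rule product_prob_space_GOE_entry)
  let ?P = "Pi\<^sub>M (upper_triangle d) (GOE_entry d)"
  let ?N = "density lborel std_normal_density"
  interpret N: prob_space ?N by (rule prob_space_normal_density) simp
  interpret pair_sigma_finite ?P ?N ..
  define c where "c p = entry_weight p * u (fst p) * u (snd p)" for p
  define L where "L g = (\<Sum>p\<in>upper_triangle d. c p * g p)" for g
  have entry [measurable]: "(\<lambda>g. g p) \<in> borel_measurable ?P" if "p \<in> upper_triangle d" for p
    using measurable_component_singleton[OF that, of "GOE_entry d"]
    by (simp add: GOE_entry_eq cong: measurable_cong_sets)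
  have L [measurable]: "L \<in> borel_measurable ?P"
    unfolding L_def by (intro borel_measurable_sum borel_measurable_times entry borel_measurable_const) auto
  have [measurable]: "(\<lambda>A. quad d A u) \<in> borel_measurable (matrix_algebra d)"
    by (rule quad_measurable)
  have "(\<integral>\<^sup>+A. ennreal (exp (real d * (quad d A u)\<^sup>2 / 8)) \<partial>GOE d)
      = (\<integral>\<^sup>+g. ennreal (exp (real d * (L g)\<^sup>2 / 8)) \<partial>?P)"
    unfolding GOE_alt by (subst nn_integral_distr[OF symmetrize_measurable]) (simp_all add: quad_symmetrized L_def c_def)
  also have "\<dots> = (\<integral>\<^sup>+g. (\<integral>\<^sup>+z. ennreal (exp (sqrt (real d) / 2 * L g * z)) \<partial>?N) \<partial>?P)"
    by (subst nn_integral_exp_linear_normal) (simp_all add: power_mult_distrib power_divide)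
  also have "\<dots> = (\<integral>\<^sup>+z. (\<integral>\<^sup>+g. ennreal (exp (sqrt (real d) / 2 * L g * z)) \<partial>?P) \<partial>?N)"
    by (rule Fubini'[symmetric]) simp
  also have "\<dots> \<le> (\<integral>\<^sup>+z. ennreal (exp (z\<^sup>2 / 4)) \<partial>?N)"
  proof (rule nn_integral_mono)
    fix z :: real
    define s where "s p = sqrt (real d) / 2 * z * c p" for p
    have "(\<integral>\<^sup>+g. ennreal (exp (sqrt (real d) / 2 * L g * z)) \<partial>?P)
        = (\<integral>\<^sup>+g. (\<Prod>p\<in>upper_triangle d. ennreal (exp (s p * g p))) \<partial>?P)"
      by (intro nn_integral_cong) (simp add: L_def s_def prod_ennreal sum_distrib_left sum_distrib_right mult_ac flip: exp_sum)
    also have "\<dots> = (\<Prod>p\<in>upper_triangle d. \<integral>\<^sup>+x. ennreal (exp (s p * x)) \<partial>GOE_entry d p)"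
      by (rule product_nn_integral_prod) (auto simp: GOE_entry_eq)
    also have "\<dots> = (\<Prod>p\<in>upper_triangle d. ennreal (exp ((s p)\<^sup>2 * ((1 + of_bool (fst p = snd p)) / real d) / 2)))"
      using assms(1) unfolding GOE_entry_eq
      by (intro prod.cong refl, subst nn_integral_exp_linear_normal) (auto simp: add_pos_nonneg)
    also have "\<dots> = ennreal (exp (\<Sum>p\<in>upper_triangle d. (s p)\<^sup>2 * ((1 + of_bool (fst p = snd p)) / real d) / 2))"
      by (simp add: prod_ennreal flip: exp_sum)
    also have "(\<Sum>p\<in>upper_triangle d. (s p)\<^sup>2 * ((1 + of_bool (fst p = snd p)) / real d) / 2)
        = z\<^sup>2 / 8 * (\<Sum>p\<in>upper_triangle d. (1 + of_bool (fst p = snd p)) * (c p)\<^sup>2)"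
      unfolding sum_distrib_left using assms(1)
      by (intro sum.cong refl) (simp add: s_def power_mult_distrib power_divide field_simps)
    also have "\<dots> = z\<^sup>2 / 8 * (2 * (sqnorm d u)\<^sup>2)"
      unfolding c_def sum_upper_triangle_coeff_le ..
    also have "ennreal (exp (z\<^sup>2 / 8 * (2 * (sqnorm d u)\<^sup>2))) \<le> ennreal (exp (z\<^sup>2 / 4))"
      using u by (intro ennreal_leI) (simp add: mult_left_le abs_square_le_1)
    finally show "(\<integral>\<^sup>+g. ennreal (exp (sqrt (real d) / 2 * L g * z)) \<partial>?P) \<le> ennreal (exp (z\<^sup>2 / 4))" .
  qed
  also have "\<dots> = ennreal (sqrt 2)" by (rule nn_integral_exp_square_std_normal)
  also have "\<dots> \<le> ennreal 2" by (intro ennreal_leI) (simp add: real_le_lsqrt)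
  finally show ?thesis .
qed

text \<open>
  Only the part of the squares above the level \<open>M\<close> is measured. Its exponential moment is at most
  \<open>1 + 2 * exp (- M / 8)\<close>, and the value of \<open>M\<close> makes this \<open>1 + \<beta> / 16\<close>, half the exponent gained in the
  Chernoff bound.
\<close>

lemma prob_excess_gt_le:
  assumes "d > 0" and u: "sqnorm d u \<le> 1" and \<beta>: "0 < \<beta>" and M: "M = 8 * ln (32 / \<beta>)"
  shows "measure (Pi\<^sub>M {..<n} (\<lambda>_. GOE d))
      {W \<in> space (Pi\<^sub>M {..<n} (\<lambda>_. GOE d)). \<beta> * real n \<le> (\<Sum>i<n. max 0 (real d * (quad d (W i) u)\<^sup>2 - M))}
    \<le> exp (- (\<beta> * real n / 16))"
proof -
  interpret product_prob_space "\<lambda>_. GOE d" "{..<n}"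
    by (intro product_prob_spaceI prob_space_GOE assms)
  let ?P = "Pi\<^sub>M {..<n} (\<lambda>_. GOE d)"
  have quad [measurable]: "(\<lambda>A. quad d A u) \<in> borel_measurable (GOE d)"
    using quad_measurable by (simp add: sets_GOE cong: measurable_cong_sets)
  define f where "f W = (\<Sum>i<n. max 0 (real d * (quad d (W i) u)\<^sup>2 - M))" for W
  have f [measurable]: "f \<in> borel_measurable ?P"
    unfolding f_def by measurable
  have one: "(\<integral>\<^sup>+A. ennreal (exp (max 0 (real d * (quad d A u)\<^sup>2 - M) / 8)) \<partial>GOE d) \<le> ennreal (exp (\<beta> / 16))"
  proof -
    have expM: "exp (- (M / 8)) = \<beta> / 32"
      using \<beta> by (simp add: M exp_minus)
    have "(\<integral>\<^sup>+A. ennreal (exp (max 0 (real d * (quad d A u)\<^sup>2 - M) / 8)) \<partial>GOE d)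
        \<le> (\<integral>\<^sup>+A. 1 + ennreal (\<beta> / 32) * ennreal (exp (real d * (quad d A u)\<^sup>2 / 8)) \<partial>GOE d)"
    proof (rule nn_integral_mono)
      fix A
      have "exp (max 0 (real d * (quad d A u)\<^sup>2 - M) / 8) \<le> 1 + exp (- (M / 8)) * exp (real d * (quad d A u)\<^sup>2 / 8)"
        by (auto simp: max_def diff_divide_distrib simp flip: exp_add)
      then show "ennreal (exp (max 0 (real d * (quad d A u)\<^sup>2 - M) / 8))
          \<le> 1 + ennreal (\<beta> / 32) * ennreal (exp (real d * (quad d A u)\<^sup>2 / 8))"
        unfolding expM using \<beta> by (simp add: ennreal_leI flip: ennreal_mult' ennreal_1 ennreal_plus)
    qed
    also have "\<dots> = 1 + ennreal (\<beta> / 32) * (\<integral>\<^sup>+A. ennreal (exp (real d * (quad d A u)\<^sup>2 / 8)) \<partial>GOE d)"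
      by (simp add: nn_integral_add nn_integral_cmult prob_space.emeasure_space_1[OF prob_space_GOE[OF assms(1)]])
    also have "\<dots> \<le> 1 + ennreal (\<beta> / 32) * ennreal 2"
      by (intro add_left_mono mult_left_mono nn_integral_exp_quad_GOE_le assms) auto
    also have "ennreal (\<beta> / 32) * ennreal 2 = ennreal (\<beta> / 16)"
      using \<beta> by (subst ennreal_mult[symmetric]) auto
    also have "1 + ennreal (\<beta> / 16) = ennreal (1 + \<beta> / 16)"
      using \<beta> by (simp flip: ennreal_1 ennreal_plus)
    also have "\<dots> \<le> ennreal (exp (\<beta> / 16))"
      by (intro ennreal_leI exp_ge_add_one_self)
    finally show ?thesis .
  qed
  have "emeasure ?P {W \<in> space ?P. \<beta> * real n \<le> f W}
      \<le> ennreal (exp (- (1 / 8) * (\<beta> * real n))) * (\<integral>\<^sup>+W. ennreal (exp (1 / 8 * f W)) * indicator (space ?P) W \<partial>?P)"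
    by (rule Chernoff_ineq_nn_integral_ge) auto
  also have "(\<integral>\<^sup>+W. ennreal (exp (1 / 8 * f W)) * indicator (space ?P) W \<partial>?P)
      = (\<integral>\<^sup>+W. (\<Prod>i<n. ennreal (exp (max 0 (real d * (quad d (W i) u)\<^sup>2 - M) / 8))) \<partial>?P)"
    by (intro nn_integral_cong) (simp add: f_def prod_ennreal sum_divide_distrib flip: exp_sum)
  also have "\<dots> = (\<Prod>i<n. \<integral>\<^sup>+A. ennreal (exp (max 0 (real d * (quad d A u)\<^sup>2 - M) / 8)) \<partial>GOE d)"
    by (rule product_nn_integral_prod) auto
  also have "\<dots> \<le> (\<Prod>i<n. ennreal (exp (\<beta> / 16)))"
    by (intro prod_mono_ennreal one)
  also have "\<dots> = ennreal (exp (\<beta> / 16 * real n))"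
    by (simp add: ennreal_power exp_of_nat_mult[symmetric] mult.commute)
  also have "ennreal (exp (- (1 / 8) * (\<beta> * real n))) * ennreal (exp (\<beta> / 16 * real n))
      = ennreal (exp (- (\<beta> * real n / 16)))"
    by (simp flip: ennreal_mult' exp_add)
  finally have "emeasure ?P {W \<in> space ?P. \<beta> * real n \<le> f W} \<le> ennreal (exp (- (\<beta> * real n / 16)))"
    by (simp add: mult_left_mono)
  then show ?thesis
    by (simp add: f_def P.emeasure_eq_measure)
qed

text \<open>
  A sum over \<open>S\<close> is split at the level \<open>M\<close>. The part above it is nonnegative, so it is bounded by the sum
  over all indices, which is the same for every \<open>S\<close>.
\<close>

lemma spread_if_excess_le:
  assumes excess: "\<And>u. u \<in> sphere_net d \<Longrightarrow>
      (\<Sum>i<n. max 0 (real d * (quad d (W i) u)\<^sup>2 - M)) \<le> \<beta> * real n"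
  shows "spread d n \<beta> M W"
  unfolding spread_def
proof (intro ballI allI impI)
  fix u S assume u: "u \<in> sphere_net d" and S: "S \<subseteq> {..<n}"
  have "real d * (\<Sum>i\<in>S. (quad d (W i) u)\<^sup>2) \<le> (\<Sum>i\<in>S. M + max 0 (real d * (quad d (W i) u)\<^sup>2 - M))"
    unfolding sum_distrib_left by (intro sum_mono) auto
  also have "\<dots> = M * real (card S) + (\<Sum>i\<in>S. max 0 (real d * (quad d (W i) u)\<^sup>2 - M))"
    by (simp add: sum.distrib)
  also have "(\<Sum>i\<in>S. max 0 (real d * (quad d (W i) u)\<^sup>2 - M)) \<le> (\<Sum>i<n. max 0 (real d * (quad d (W i) u)\<^sup>2 - M))"
    using S by (intro sum_mono2) auto
  also have "\<dots> \<le> \<beta> * real n" by (rule excess[OF u])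
  finally show "real d * (\<Sum>i\<in>S. (quad d (W i) u)\<^sup>2) \<le> M * real (card S) + \<beta> * real n" by simp
qed

section \<open>Measurability of the operator norm\<close>

text \<open>
  The rational approximations by which integer vectors, after scaling, reach every real vector.
\<close>

lemma floor_fraction_tendsto:
  fixes x :: real
  shows "(\<lambda>k. real_of_int \<lfloor>real k * x\<rfloor> / real k) \<longlonglongrightarrow> x"
proof (rule tendsto_sandwich)
  have bounds: "x - 1 / real k \<le> real_of_int \<lfloor>real k * x\<rfloor> / real k \<and> real_of_int \<lfloor>real k * x\<rfloor> / real k \<le> x" if "k > 0" for k
  proof -
    have "(real k * x - 1) / real k \<le> real_of_int \<lfloor>real k * x\<rfloor> / real k"
      by (intro divide_right_mono) (linarith, simp)
    moreover have "real_of_int \<lfloor>real k * x\<rfloor> / real k \<le> (real k * x) / real k"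
      by (intro divide_right_mono) auto
    ultimately show ?thesis using that by (simp add: diff_divide_distrib)
  qed
  show "\<forall>\<^sub>F k in sequentially. x - 1 / real k \<le> real_of_int \<lfloor>real k * x\<rfloor> / real k"
    using eventually_gt_at_top[of 0] by eventually_elim (use bounds in blast)
  show "\<forall>\<^sub>F k in sequentially. real_of_int \<lfloor>real k * x\<rfloor> / real k \<le> x"
    using eventually_gt_at_top[of 0] by eventually_elim (use bounds in blast)
  show "(\<lambda>k. x - 1 / real k) \<longlonglongrightarrow> x"
    using tendsto_diff[OF tendsto_const lim_1_over_n, of x] by simp
qed simp

text \<open>
  By homogeneity and density, integer vectors test the operator norm. As there are countably many of
  them, this makes events about the supremum over the unit ball measurable.
\<close>

lemma op_norm_le_iff_integer_vectors:
  assumes "0 \<le> c"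
  shows "op_norm d A \<le> c \<longleftrightarrow> (\<forall>z \<in> {..<d} \<rightarrow>\<^sub>E (UNIV :: int set).
    sqnorm d (\<lambda>i. \<Sum>j<d. A (i, j) * real_of_int (z j)) \<le> c\<^sup>2 * sqnorm d (\<lambda>i. real_of_int (z i)))"
    (is "_ \<longleftrightarrow> (\<forall>z\<in>?Z. ?le z)")
proof
  assume le: "op_norm d A \<le> c"
  let ?B = "{x. L2_set x {..<d} \<le> 1}"
  let ?f = "\<lambda>x. L2_set (\<lambda>i. \<Sum>j<d. A (i, j) * x j) {..<d}"
  have "bdd_above (?f ` ?B)"
  proof (rule bdd_aboveI2)
    fix x assume x: "x \<in> ?B"
    have "?f x \<le> (\<Sum>i<d. \<bar>\<Sum>j<d. A (i, j) * x j\<bar>)" by (rule L2_set_le_sum_abs)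
    also have "\<dots> \<le> (\<Sum>i<d. \<Sum>j<d. \<bar>A (i, j)\<bar>)"
    proof (intro sum_mono order.trans[OF sum_abs])
      fix i j assume "j \<in> {..<d}"
      then have "\<bar>x j\<bar> \<le> L2_set (\<lambda>j. \<bar>x j\<bar>) {..<d}"
        by (intro member_le_L2_set) auto
      also have "\<dots> \<le> 1" using x by (simp add: L2_set_def)
      finally show "\<bar>A (i, j) * x j\<bar> \<le> \<bar>A (i, j)\<bar>" by (simp add: abs_mult mult_left_le)
    qed
    finally show "?f x \<le> (\<Sum>i<d. \<Sum>j<d. \<bar>A (i, j)\<bar>)" .
  qed
  then have f_le: "?f x \<le> c" if "x \<in> ?B" for x
    using le cSUP_upper[OF that] by (fastforce simp: op_norm_def)
  show "\<forall>z\<in>?Z. ?le z"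
  proof
    fix z :: "nat \<Rightarrow> int" assume "z \<in> ?Z"
    define y where "y i = real_of_int (z i)" for i
    show "?le z"
    proof (cases "sqnorm d y = 0")
      case True
      then have "y i = 0" if "i < d" for i
        using that by (simp add: sqnorm_def sum_nonneg_eq_0_iff)
      then show ?thesis by (simp add: sqnorm_def y_def)
    next
      case False
      define s where "s = sqnorm d y"
      have "s > 0" using False sqnorm_nonneg[of d y] unfolding s_def by linarith
      define x where "x = (\<lambda>i. 1 / sqrt s * y i)"
      have "sqnorm d x = 1"
        unfolding x_def sqnorm_scale using \<open>s > 0\<close> by (simp add: s_def power_divide)
      then have "?f x \<le> c" by (intro f_le) (simp add: L2_set_def sqnorm_def)
      then have "(?f x)\<^sup>2 \<le> c\<^sup>2" by (intro power_mono) auto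
      then have "sqnorm d (\<lambda>i. \<Sum>j<d. A (i, j) * x j) \<le> c\<^sup>2"
        by (simp add: L2_set_def sqnorm_def sum_nonneg)
      then have "s * sqnorm d (\<lambda>i. \<Sum>j<d. A (i, j) * x j) \<le> s * c\<^sup>2"
        using \<open>s > 0\<close> by (intro mult_left_mono) auto
      moreover have "s * sqnorm d (\<lambda>i. \<Sum>j<d. A (i, j) * x j) = sqnorm d (\<lambda>i. \<Sum>j<d. A (i, j) * y j)"
      proof -
        have "(\<lambda>i. \<Sum>j<d. A (i, j) * x j) = (\<lambda>i. 1 / sqrt s * (\<Sum>j<d. A (i, j) * y j))"
          by (simp add: x_def sum_distrib_left sum_divide_distrib)
        then show ?thesis using \<open>s > 0\<close> by (simp only: sqnorm_scale) (simp add: power_divide)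
      qed
      ultimately have "sqnorm d (\<lambda>i. \<Sum>j<d. A (i, j) * y j) \<le> c\<^sup>2 * s"
        by (simp add: mult.commute)
      then show ?thesis unfolding s_def y_def .
    qed
  qed
next
  assume le: "\<forall>z\<in>?Z. ?le z"
  show "op_norm d A \<le> c"
    unfolding op_norm_def
  proof (rule cSUP_least)
    have "(\<lambda>_. 0) \<in> {x. L2_set x {..<d} \<le> 1}" by (simp add: L2_set_def)
    then show "{x. L2_set x {..<d} \<le> 1} \<noteq> {}" by blast
  next
    fix x assume "x \<in> {x. L2_set x {..<d} \<le> 1}"
    then have x: "sqnorm d x \<le> 1" by (simp add: L2_set_def sqnorm_def)
    define y where "y k i = real_of_int \<lfloor>real k * x i\<rfloor> / real k" for k i
    have y: "(\<lambda>k. y k i) \<longlonglongrightarrow> x i" for i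
      unfolding y_def by (rule floor_fraction_tendsto)
    have y_le: "sqnorm d (\<lambda>i. \<Sum>j<d. A (i, j) * y k j) \<le> c\<^sup>2 * sqnorm d (y k)" for k
    proof -
      define z where "z = (\<lambda>i\<in>{..<d}. \<lfloor>real k * x i\<rfloor>)"
      have "z \<in> ?Z" by (auto simp: z_def)
      then have "(1 / real k)\<^sup>2 * sqnorm d (\<lambda>i. \<Sum>j<d. A (i, j) * real_of_int (z j))
          \<le> (1 / real k)\<^sup>2 * (c\<^sup>2 * sqnorm d (\<lambda>i. real_of_int (z i)))"
        using le by (intro mult_left_mono) auto
      moreover have "(1 / real k)\<^sup>2 * sqnorm d (\<lambda>i. real_of_int (z i)) = sqnorm d (y k)"
        unfolding sqnorm_scale[symmetric] by (simp add: sqnorm_def z_def y_def)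
      moreover have "(1 / real k)\<^sup>2 * sqnorm d (\<lambda>i. \<Sum>j<d. A (i, j) * real_of_int (z j))
          = sqnorm d (\<lambda>i. \<Sum>j<d. A (i, j) * y k j)"
        unfolding sqnorm_scale[symmetric] by (simp add: sqnorm_def z_def y_def sum_divide_distrib)
      ultimately show ?thesis by (simp add: mult.left_commute)
    qed
    have "sqnorm d (\<lambda>i. \<Sum>j<d. A (i, j) * x j) \<le> c\<^sup>2 * sqnorm d x"
    proof (rule LIMSEQ_le)
      show "(\<lambda>k. sqnorm d (\<lambda>i. \<Sum>j<d. A (i, j) * y k j)) \<longlonglongrightarrow> sqnorm d (\<lambda>i. \<Sum>j<d. A (i, j) * x j)"
        unfolding sqnorm_def by (intro tendsto_intros y)
      show "(\<lambda>k. c\<^sup>2 * sqnorm d (y k)) \<longlonglongrightarrow> c\<^sup>2 * sqnorm d x"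
        unfolding sqnorm_def by (intro tendsto_intros y)
    qed (use y_le in blast)
    also have "\<dots> \<le> c\<^sup>2" using x by (simp add: mult_left_le)
    finally show "L2_set (\<lambda>i. \<Sum>j<d. A (i, j) * x j) {..<d} \<le> c"
      using assms by (auto simp: L2_set_def sqnorm_def intro: real_le_lsqrt sum_nonneg)
  qed
qed

lemma small_signing_event_measurable:
  fixes n :: nat
  assumes "0 \<le> c"
  shows "{W \<in> space (Pi\<^sub>M {..<n} (\<lambda>_. GOE d)). \<exists>\<epsilon>\<in>{..<n} \<rightarrow> {-1, 1}.
      op_norm d (\<lambda>p. \<Sum>i<n. \<epsilon> i * W i p) \<le> c} \<in> sets (Pi\<^sub>M {..<n} (\<lambda>_. GOE d))"
proof -
  let ?P = "Pi\<^sub>M {..<n} (\<lambda>_. GOE d)"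
  let ?Z = "{..<d} \<rightarrow>\<^sub>E (UNIV :: int set)"
  let ?A = "\<lambda>\<epsilon> W p. \<Sum>i<n. \<epsilon> i * W i p :: real"
  let ?le = "\<lambda>\<epsilon> W z. sqnorm d (\<lambda>i. \<Sum>j<d. ?A \<epsilon> W (i, j) * real_of_int (z j)) \<le> c\<^sup>2 * sqnorm d (\<lambda>i. real_of_int (z i))"
  have ex_signings: "(\<exists>\<epsilon>\<in>{..<n} \<rightarrow> {-1, 1}. op_norm d (?A \<epsilon> W) \<le> c)
      \<longleftrightarrow> (\<exists>\<epsilon>\<in>signings {..<n}. op_norm d (?A \<epsilon> W) \<le> c)" for W
  proof
    assume "\<exists>\<epsilon>\<in>{..<n} \<rightarrow> {-1, 1}. op_norm d (?A \<epsilon> W) \<le> c"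
    then obtain \<epsilon> where \<epsilon>: "\<epsilon> \<in> {..<n} \<rightarrow> {-1, 1}" "op_norm d (?A \<epsilon> W) \<le> c" by blast
    have "?A (restrict \<epsilon> {..<n}) W = ?A \<epsilon> W" by (intro ext sum.cong) auto
    then show "\<exists>\<epsilon>\<in>signings {..<n}. op_norm d (?A \<epsilon> W) \<le> c"
      using \<epsilon> by (intro bexI[of _ "restrict \<epsilon> {..<n}"]) (auto simp only: signings_def restrict_PiE_iff Pi_iff)
  qed (auto simp: signings_def PiE_def)
  have entry: "(\<lambda>W. W k (i, j)) \<in> borel_measurable ?P" if "k < n" "i < d" "j < d" for k i j
  proof -
    have "(\<lambda>A. A (i, j)) \<in> borel_measurable (GOE d)"
      using entry_measurable[OF that(2,3)] by (simp add: sets_GOE cong: measurable_cong_sets)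
    then show ?thesis
      by (rule measurable_compose[rotated]) (use that(1) in \<open>auto intro: measurable_component_singleton\<close>)
  qed
  have "{W \<in> space ?P. \<exists>\<epsilon>\<in>signings {..<n}. \<forall>z\<in>?Z. ?le \<epsilon> W z} \<in> sets ?P"
  proof (rule sets.sets_Collect_finite_Ex)
    fix \<epsilon> :: "nat \<Rightarrow> real"
    have le: "{W \<in> space ?P. ?le \<epsilon> W z} \<in> sets ?P" for z :: "nat \<Rightarrow> int"
      unfolding sqnorm_def
      by (intro borel_measurable_le borel_measurable_sum borel_measurable_power borel_measurable_times
          borel_measurable_const entry) auto
    have "{W \<in> space ?P. \<forall>z\<in>?Z. ?le \<epsilon> W z} = space ?P - (\<Union>z\<in>?Z. space ?P - {W \<in> space ?P. ?le \<epsilon> W z})"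
      by blast
    also have "\<dots> \<in> sets ?P"
      using le by (intro sets.Diff sets.top sets.countable_UN' countable_PiE) auto
    finally show "{W \<in> space ?P. \<forall>z\<in>?Z. ?le \<epsilon> W z} \<in> sets ?P" .
  qed (simp add: finite_signings)
  then have "{W \<in> space ?P. \<exists>\<epsilon>\<in>signings {..<n}. op_norm d (?A \<epsilon> W) \<le> c} \<in> sets ?P"
    unfolding op_norm_le_iff_integer_vectors[OF assms] .
  then show ?thesis
    unfolding ex_signings .
qed

section \<open>Probability of a small signed sum\<close>

lemma prob_small_signing_ge:
  assumes "d > 0" and \<beta>: "0 < \<beta>" "\<beta> \<le> 1" and M: "M = 8 * ln (32 / \<beta>)"
    and \<eta>: "0 < \<eta>" "\<eta> * M \<le> \<beta>" "(7 / 8) ^ k \<le> \<eta>" and "\<delta> > 0"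
    and large: "4 * (320 * (M + 1) / \<delta>\<^sup>2 + 5) * (real d)\<^sup>2 \<le> \<eta> * real n"
    and \<kappa>: "40 * \<delta> * real k + 2 * sqrt (80 * \<beta>) \<le> \<kappa>"
  shows "1 - exp (18 * real d - \<beta> * real n / 16)
    \<le> \<P>(W in Pi\<^sub>M {..<n} (\<lambda>_. GOE d). \<exists>\<epsilon>\<in>{..<n} \<rightarrow> {-1, 1}.
          1 / sqrt (real n) * op_norm d (\<lambda>p. \<Sum>i<n. \<epsilon> i * W i p) \<le> \<kappa>)"
proof -
  interpret product_prob_space "\<lambda>_. GOE d" "{..<n}"
    by (intro product_prob_spaceI prob_space_GOE assms)
  let ?P = "Pi\<^sub>M {..<n} (\<lambda>_. GOE d)"
  define f where "f u W = (\<Sum>i<n. max 0 (real d * (quad d (W i) u)\<^sup>2 - M))" for u and W :: "nat \<Rightarrow> nat \<times> nat \<Rightarrow> real"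
  define bad where "bad u = {W \<in> space ?P. \<beta> * real n \<le> f u W}" for u
  define good where "good = space ?P - (\<Union>u\<in>sphere_net d. bad u)"
  let ?small = "\<lambda>W. \<exists>\<epsilon>\<in>{..<n} \<rightarrow> {-1, 1}. 1 / sqrt (real n) * op_norm d (\<lambda>p. \<Sum>i<n. \<epsilon> i * W i p) \<le> \<kappa>"
  have "M \<ge> 0" using \<beta> by (simp add: M)
  have "0 < 4 * (320 * (M + 1) / \<delta>\<^sup>2 + 5) * (real d)\<^sup>2"
    using \<open>0 \<le> M\<close> \<open>d > 0\<close> by (intro mult_pos_pos add_nonneg_pos) auto
  then have "n > 0" using large by (cases n) auto
  have "0 \<le> 40 * \<delta> * real k + 2 * sqrt (80 * \<beta>)" using \<open>\<delta> > 0\<close> \<beta> by simp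
  then have "0 \<le> \<kappa>" using \<kappa> by linarith
  have rescale: "1 / sqrt (real n) * x \<le> \<kappa> \<longleftrightarrow> x \<le> \<kappa> * sqrt (real n)" for x
    using \<open>n > 0\<close> by (simp add: field_simps)
  have quad [measurable]: "(\<lambda>A. quad d A u) \<in> borel_measurable (GOE d)" for u
    using quad_measurable by (simp add: sets_GOE cong: measurable_cong_sets)
  have bad_sets: "bad u \<in> sets ?P" for u
    unfolding bad_def f_def by measurable
  have "measure ?P (\<Union>u\<in>sphere_net d. bad u) \<le> (\<Sum>u\<in>sphere_net d. measure ?P (bad u))"
    using bad_sets by (intro P.finite_measure_subadditive_finite finite_sphere_net) auto
  also have "\<dots> \<le> (\<Sum>u\<in>sphere_net d. exp (- (\<beta> * real n / 16)))"
    unfolding bad_def f_def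
    by (intro sum_mono prob_excess_gt_le \<open>d > 0\<close> sqnorm_sphere_net_le \<beta>(1) M)
  also have "\<dots> = real (card (sphere_net d)) * exp (- (\<beta> * real n / 16))" by simp
  also have "\<dots> \<le> exp (18 * real d) * exp (- (\<beta> * real n / 16))"
    by (intro mult_right_mono card_sphere_net_le) simp
  also have "\<dots> = exp (18 * real d - \<beta> * real n / 16)" by (simp flip: exp_add)
  finally have "1 - exp (18 * real d - \<beta> * real n / 16) \<le> measure ?P good"
    unfolding good_def using bad_sets
    by (subst P.prob_compl) (auto intro!: sets.finite_UN finite_sphere_net)
  also have "\<dots> \<le> measure ?P {W \<in> space ?P. ?small W}"
  proof (rule P.finite_measure_mono_AE)
    show "{W \<in> space ?P. ?small W} \<in> sets ?P"
      unfolding rescale using \<open>0 \<le> \<kappa>\<close> by (intro small_signing_event_measurable) simp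
    \<comment> \<open>Symmetry holds only almost surely, so the inclusion of events does too.\<close>
    have "AE W in ?P. \<forall>i\<in>{..<n}. symmetric_matrix d (W i)"
      using AE_GOE_symmetric by (intro AE_finite_allI AE_component) auto
    then show "AE W in ?P. W \<in> good \<longrightarrow> W \<in> {W \<in> space ?P. ?small W}"
    proof (rule AE_mp, intro AE_I2 impI)
      fix W assume W: "\<forall>i\<in>{..<n}. symmetric_matrix d (W i)" "W \<in> good"
      have "spread d n \<beta> M W"
        using W(2) by (intro spread_if_excess_le) (auto simp: good_def bad_def f_def)
      then obtain \<epsilon> where \<epsilon>: "\<epsilon> \<in> {..<n} \<rightarrow> {-1, 1}"
        and le: "op_norm d (\<lambda>p. \<Sum>i<n. \<epsilon> i * W i p) \<le> (40 * \<delta> * real k + 2 * sqrt (80 * \<beta>)) * sqrt (real n)"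
        using exists_signing_of_small_op_norm[of d n W \<beta> M \<eta> k \<delta>] W(1) assms \<open>0 \<le> M\<close> by auto
      have "op_norm d (\<lambda>p. \<Sum>i<n. \<epsilon> i * W i p) \<le> \<kappa> * sqrt (real n)"
        using \<kappa> by (intro order.trans[OF le] mult_right_mono) auto
      then show "W \<in> {W \<in> space ?P. ?small W}"
        unfolding rescale using \<epsilon> W(2) by (auto simp: good_def)
    qed
  qed
  finally show ?thesis .
qed

lemma exp_linear_minus_quadratic_tendsto_zero:
  assumes "c > 0"
  shows "(\<lambda>d. exp (a * real d - c * (real d)\<^sup>2)) \<longlonglongrightarrow> 0"
proof (rule tendsto_sandwich[of "\<lambda>_. 0" _ _ "\<lambda>d. exp (- 1) ^ d"])
  show "(\<lambda>d. exp (- 1 :: real) ^ d) \<longlonglongrightarrow> 0"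
    by (rule LIMSEQ_realpow_zero) auto
  obtain N where N: "(a + 1) / c \<le> real N" using real_arch_simple by blast
  have "exp (a * real d - c * (real d)\<^sup>2) \<le> exp (- 1) ^ d" if "N \<le> d" for d
  proof -
    have "a + 1 \<le> c * real d" using N that assms by (simp add: field_simps) (meson mult_left_mono of_nat_mono order_trans less_imp_le)
    then have "(a + 1) * real d \<le> c * real d * real d" by (rule mult_right_mono) simp
    then have "a * real d - c * (real d)\<^sup>2 \<le> real d * (- 1)" by (simp add: algebra_simps power2_eq_square)
    then show ?thesis unfolding exp_of_nat_mult[symmetric] by simp
  qed
  then show "\<forall>\<^sub>F d in sequentially. exp (a * real d - c * (real d)\<^sup>2) \<le> exp (- 1) ^ d"
    by (auto simp: eventually_sequentially)
qed auto

text \<open>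
  The parameters are chosen in the order \<open>\<beta>\<close>, \<open>M\<close>, \<open>\<eta>\<close>, \<open>k\<close>, \<open>\<delta>\<close>: half of \<open>\<kappa>\<close> is reserved for the final signs
  and half for the \<open>k\<close> rounds of partial colouring. All of them depend on \<open>\<kappa>\<close> only, so \<open>n\<close> merely has to
  exceed a constant multiple of \<open>d\<^sup>2\<close>.
\<close>

lemma exists_aspect_ratio_threshold:
  fixes \<kappa> :: real
  assumes \<kappa>: "0 < \<kappa>" "\<kappa> \<le> 1"
  shows "\<exists>T>0. \<forall>\<tau>\<ge>T. \<forall>n. (\<lambda>d. real (n d) / (real d)\<^sup>2) \<longlonglongrightarrow> \<tau> \<longrightarrow>
        (\<lambda>d. \<P>(W in Pi\<^sub>M {..<n d} (\<lambda>_. GOE d).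
               \<exists>\<epsilon>\<in>{..<n d} \<rightarrow> {-1, 1}.
                 1 / sqrt (real (n d)) * op_norm d (\<lambda>p. \<Sum>i<n d. \<epsilon> i * W i p) \<le> \<kappa>))
          \<longlonglongrightarrow> 1"
proof -
  define \<beta> where "\<beta> = \<kappa>\<^sup>2 / 1280"
  have "\<kappa>\<^sup>2 \<le> 1" using \<kappa> by (simp add: abs_square_le_1)
  then have \<beta>: "0 < \<beta>" "\<beta> \<le> 1" using \<kappa> by (auto simp: \<beta>_def)
  define M where "M = 8 * ln (32 / \<beta>)"
  have "M \<ge> 0" using \<beta> by (simp add: M_def)
  define \<eta> where "\<eta> = \<beta> / (M + 1)"
  have \<eta>: "0 < \<eta>" "\<eta> * M \<le> \<beta>" using \<beta> \<open>M \<ge> 0\<close> by (auto simp: \<eta>_def field_simps)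
  obtain k where k: "(7 / 8) ^ k < \<eta>" using real_arch_pow_inv[OF \<eta>(1), of "7 / 8"] by auto
  define \<delta> where "\<delta> = \<kappa> / (80 * (real k + 1))"
  have "\<delta> > 0" using \<kappa> by (simp add: \<delta>_def add_nonneg_pos)
  have \<kappa>_bound: "40 * \<delta> * real k + 2 * sqrt (80 * \<beta>) \<le> \<kappa>"
  proof -
    have "80 * \<beta> = (\<kappa> / 4)\<^sup>2" by (simp add: \<beta>_def power_divide)
    then have "sqrt (80 * \<beta>) = \<kappa> / 4" using \<kappa> by simp
    moreover have "40 * \<delta> * real k \<le> \<kappa> / 2" using \<kappa> by (simp add: \<delta>_def field_simps)
    ultimately show ?thesis by simp
  qed
  define C where "C = 4 * (320 * (M + 1) / \<delta>\<^sup>2 + 5)"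
  have "C > 0" using \<open>M \<ge> 0\<close> by (simp add: C_def add_nonneg_pos)
  show ?thesis
  proof (intro exI[of _ "2 * C / \<eta>"] conjI allI impI)
    show "2 * C / \<eta> > 0" using \<open>C > 0\<close> \<eta> by simp
    fix \<tau> and n :: "nat \<Rightarrow> nat"
    assume \<tau>: "2 * C / \<eta> \<le> \<tau>" and n: "(\<lambda>d. real (n d) / (real d)\<^sup>2) \<longlonglongrightarrow> \<tau>"
    have "\<tau> > 0" using \<tau> \<open>2 * C / \<eta> > 0\<close> by linarith
    have "\<forall>\<^sub>F d in sequentially. \<tau> / 2 < real (n d) / (real d)\<^sup>2"
      using order_tendstoD(1)[OF n, of "\<tau> / 2"] \<open>\<tau> > 0\<close> by simp
    then have n_ge: "\<forall>\<^sub>F d in sequentially. 0 < d \<and> \<tau> / 2 * (real d)\<^sup>2 \<le> real (n d)"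
      using eventually_gt_at_top[of 0] by eventually_elim (simp add: field_simps)
    let ?p = "\<lambda>d. \<P>(W in Pi\<^sub>M {..<n d} (\<lambda>_. GOE d). \<exists>\<epsilon>\<in>{..<n d} \<rightarrow> {-1, 1}.
      1 / sqrt (real (n d)) * op_norm d (\<lambda>p. \<Sum>i<n d. \<epsilon> i * W i p) \<le> \<kappa>)"
    show "?p \<longlonglongrightarrow> 1"
    proof (rule tendsto_sandwich)
      show "(\<lambda>d. 1 - exp (18 * real d - \<beta> * \<tau> / 32 * (real d)\<^sup>2)) \<longlonglongrightarrow> 1"
        using tendsto_diff[OF tendsto_const exp_linear_minus_quadratic_tendsto_zero[of "\<beta> * \<tau> / 32" 18], of 1]
          \<beta> \<open>\<tau> > 0\<close> by simp
      show "\<forall>\<^sub>F d in sequentially. 1 - exp (18 * real d - \<beta> * \<tau> / 32 * (real d)\<^sup>2) \<le> ?p d"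
        using n_ge
      proof eventually_elim
        fix d assume d: "0 < d \<and> \<tau> / 2 * (real d)\<^sup>2 \<le> real (n d)"
        have "C * (real d)\<^sup>2 \<le> \<eta> * (\<tau> / 2) * (real d)\<^sup>2"
          using \<tau> \<eta> by (intro mult_right_mono) (auto simp: field_simps)
        also have "\<dots> \<le> \<eta> * real (n d)"
          unfolding mult.assoc using d \<eta> by (intro mult_left_mono) auto
        finally have large: "4 * (320 * (M + 1) / \<delta>\<^sup>2 + 5) * (real d)\<^sup>2 \<le> \<eta> * real (n d)"
          by (simp add: C_def)
        have "\<beta> * (\<tau> / 2 * (real d)\<^sup>2) \<le> \<beta> * real (n d)"
          using d \<beta> by (intro mult_left_mono) auto
        then have "18 * real d - \<beta> * real (n d) / 16 \<le> 18 * real d - \<beta> * \<tau> / 32 * (real d)\<^sup>2"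
          by simp
        then have "1 - exp (18 * real d - \<beta> * \<tau> / 32 * (real d)\<^sup>2) \<le> 1 - exp (18 * real d - \<beta> * real (n d) / 16)"
          by simp
        also have "\<dots> \<le> ?p d"
          using d k by (intro prob_small_signing_ge[OF _ \<beta> M_def \<eta> _ \<open>\<delta> > 0\<close> large \<kappa>_bound]) auto
        finally show "1 - exp (18 * real d - \<beta> * \<tau> / 32 * (real d)\<^sup>2) \<le> ?p d" .
      qed
      show "\<forall>\<^sub>F d in sequentially. ?p d \<le> 1"
        using eventually_gt_at_top[of 0]
      proof eventually_elim
        fix d :: nat assume "0 < d"
        then interpret prob_space "Pi\<^sub>M {..<n d} (\<lambda>_. GOE d)"
          by (intro prob_space_PiM prob_space_GOE)
        show "?p d \<le> 1" by (rule prob_le_1)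
      qed
    qed simp
  qed
qed

section \<open>Letting the bound tend to zero\<close>

theorem corollary1p10:
  "\<exists>(\<tau>\<^sub>0::real) (\<kappa>\<^sub>c::real \<Rightarrow> real).
     \<tau>\<^sub>0 > 0 \<and>
     \<kappa>\<^sub>c \<in> {\<tau>\<^sub>0..} \<rightarrow> {0<..<2} \<and>
     (\<kappa>\<^sub>c \<longlongrightarrow> 0) at_top \<and>
     (\<forall>\<tau>\<ge>\<tau>\<^sub>0. \<forall>n :: nat \<Rightarrow> nat.
        (\<lambda>d. real (n d) / (real d)\<^sup>2) \<longlonglongrightarrow> \<tau> \<longrightarrow>
        (\<lambda>d. \<P>(W in Pi\<^sub>M {..<n d} (\<lambda>_. GOE d).
               \<exists>\<epsilon>\<in>{..<n d} \<rightarrow> {-1, 1}.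
                 1 / sqrt (real (n d)) * op_norm d (\<lambda>p. \<Sum>i<n d. \<epsilon> i * W i p) \<le> \<kappa>\<^sub>c \<tau>))
          \<longlonglongrightarrow> 1)"
proof -
  define whp where "whp \<tau> \<kappa> \<longleftrightarrow> (\<forall>n :: nat \<Rightarrow> nat.
        (\<lambda>d. real (n d) / (real d)\<^sup>2) \<longlonglongrightarrow> \<tau> \<longrightarrow>
        (\<lambda>d. \<P>(W in Pi\<^sub>M {..<n d} (\<lambda>_. GOE d).
               \<exists>\<epsilon>\<in>{..<n d} \<rightarrow> {-1, 1}.
                 1 / sqrt (real (n d)) * op_norm d (\<lambda>p. \<Sum>i<n d. \<epsilon> i * W i p) \<le> \<kappa>))
          \<longlonglongrightarrow> 1)" for \<tau> \<kappa> :: real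
  have "\<forall>m :: nat. \<exists>T>0. \<forall>\<tau>\<ge>T. whp \<tau> (1 / real (Suc m))"
    unfolding whp_def by (intro allI exists_aspect_ratio_threshold) auto
  then obtain T where T: "\<And>m. T m > 0" "\<And>m \<tau>. T m \<le> \<tau> \<Longrightarrow> whp \<tau> (1 / real (Suc m))"
    by metis
  \<comment> \<open>The thresholds need not be monotone or unbounded in \<open>m\<close>; \<open>T'\<close> dominates them and tends to infinity, so that the maximum below exists.\<close>
  define T' where "T' m = real m + (\<Sum>j\<le>m. T j)" for m
  have T'_ge: "real m \<le> T' m" "T m \<le> T' m" for m
  proof -
    show "real m \<le> T' m" using T(1) by (simp add: T'_def sum_nonneg less_imp_le)
    have "T m \<le> (\<Sum>j\<le>m. T j)" using T(1) by (intro member_le_sum) (auto intro: less_imp_le)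
    then show "T m \<le> T' m" by (simp add: T'_def)
  qed
  define idx where "idx \<tau> = Max {m. T' m \<le> \<tau>}" for \<tau>
  have fin: "finite {m. T' m \<le> \<tau>}" for \<tau>
  proof (rule finite_subset)
    show "{m. T' m \<le> \<tau>} \<subseteq> {..nat \<lfloor>\<tau>\<rfloor>}"
      by (auto intro!: le_nat_floor order.trans[OF T'_ge(1)])
  qed simp
  have idx: "T' (idx \<tau>) \<le> \<tau>" if "T' 0 \<le> \<tau>" for \<tau>
    using Max_in[OF fin, of \<tau>] that unfolding idx_def by blast
  have idx_ge: "m \<le> idx \<tau>" if "T' m \<le> \<tau>" for m \<tau>
    unfolding idx_def using fin that by (intro Max_ge) auto
  define \<kappa>\<^sub>c where "\<kappa>\<^sub>c \<tau> = 1 / real (Suc (idx \<tau>))" for \<tau>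
  have "T' 0 > 0" using T(1) by (simp add: T'_def)
  moreover have "\<kappa>\<^sub>c \<in> {T' 0..} \<rightarrow> {0<..<2}"
    by (auto simp: \<kappa>\<^sub>c_def field_simps)
  moreover have "(\<kappa>\<^sub>c \<longlongrightarrow> 0) at_top"
  proof -
    have "filterlim idx at_top at_top"
      unfolding filterlim_at_top
      using idx_ge by (auto intro: eventually_mono[OF eventually_ge_at_top])
    then have "((\<lambda>\<tau>. inverse (real (Suc (idx \<tau>)))) \<longlongrightarrow> 0) at_top"
      by (rule filterlim_compose[OF LIMSEQ_inverse_real_of_nat])
    moreover have "\<kappa>\<^sub>c = (\<lambda>\<tau>. inverse (real (Suc (idx \<tau>))))"
      by (simp add: \<kappa>\<^sub>c_def fun_eq_iff inverse_eq_divide)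
    ultimately show ?thesis by (simp only:)
  qed
  moreover have "whp \<tau> (\<kappa>\<^sub>c \<tau>)" if "T' 0 \<le> \<tau>" for \<tau>
    unfolding \<kappa>\<^sub>c_def using idx[OF that] T'_ge(2)[of "idx \<tau>"] by (intro T(2)) linarith
  ultimately show ?thesis unfolding whp_def by blast
qed

end
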